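(* Let $\kappa_0\ge1$ be fixed and assume $\kappa\le\kappa_0$. Let $c_d\ge2$. There is a constant $c_0>0$ such that if $p\ge c_0\frac{\log n}{n}$ and $d\ge c_d np$, then with probability at least $1-O(n^{-5})$, $$\frac{\|\pi-\pi^*\|_2}{\|\pi^*\|_2}\le\frac{C}{\sqrt{npL}},$$ where $C$ depends only on $\kappa_0$ and $c_d$.
   Context: Bradley–Terry–Luce (BTL) setup. There are $n$ items with unknown preference scores $w_1^*\ge w_2^*\ge\cdots\ge w_n^*>0$, all lying in $[w_{\min},w_{\max}]$ with $w_{\min}>0$; set $\theta_i^*=\log w_i^*$ and $\kappa=w_{\max}/w_{\min}$. A comparison graph $\mathcal G=(\{1,\dots,n\},\mathcal E)$ is drawn from the Erdős–Rényi model $\mathcal G_{n,p}$ (each unordered pair is an edge independently with probability $p$). For each edge $(i,j)\in\mathcal E$ one observes $L$ comparisons $y_{i,j}^{(l)}$, $l=1,\dots,L$, where $y_{i,j}^{(l)}=1$ with probability $y^*_{i,j}:=\frac{w_j^*}{w_i^*+w_j^*}$ and $0$ otherwise, with the convention $y_{j,i}^{(l)}=1-y_{i,j}^{(l)}$; all comparisons are mutually independent and independent of $\mathcal G$. Let $y_{i,j}=\frac1L\sum_{l=1}^L y_{i,j}^{(l)}$. Spectral method: for $d>0$ define $P$ by $P_{i,j}=\frac1d y_{i,j}$ if $(i,j)\in\mathcal E$, $P_{i,i}=1-\frac1d\sum_{k:(i,k)\in\mathcal E}y_{i,k}$, and $P_{i,j}=0$ otherwise; $\pi$ is the stationary distribution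 of $P$ (leading left eigenvector normalized to sum to $1$). The normalized score vector is $\pi^*=\frac{1}{\sum_i w_i^*}(w_1^*,\dots,w_n^* )^\top$. *)

theory Defs
  imports "HOL-Probability.Probability"
begin

text \<open>Items are 0,...,n-1. A sample consists of the Erdos-Renyi graph, encoded by
  the indicator G (i,j) for pairs i < j < n, and all comparison outcomes
  Y (i,j,l) for i < j < n, l < L (outcomes for non-edges are sampled too but never
  used; this does not change the joint law of the observed data).\<close>

type_synonym btl_sample = "((nat \<times> nat) \<Rightarrow> bool) \<times> ((nat \<times> nat \<times> nat) \<Rightarrow> bool)"

definition btl_graph_pmf :: "nat \<Rightarrow> real \<Rightarrow> ((nat \<times> nat) \<Rightarrow> bool) pmf" where
  "btl_graph_pmf n p = Pi_pmf {(i, j). i < j \<and> j < n} False (\<lambda>_. bernoulli_pmf p)"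

text \<open>Y (i,j,l) = True means y_{i,j}^{(l)} = 1, which has probability w_j / (w_i + w_j).\<close>
definition btl_comp_pmf :: "nat \<Rightarrow> nat \<Rightarrow> (nat \<Rightarrow> real) \<Rightarrow> ((nat \<times> nat \<times> nat) \<Rightarrow> bool) pmf" where
  "btl_comp_pmf n L w = Pi_pmf {(i, j, l). i < j \<and> j < n \<and> l < L} False
      (\<lambda>(i, j, l). bernoulli_pmf (w j / (w i + w j)))"

definition btl_pmf :: "nat \<Rightarrow> nat \<Rightarrow> real \<Rightarrow> (nat \<Rightarrow> real) \<Rightarrow> btl_sample pmf" where
  "btl_pmf n L p w = pair_pmf (btl_graph_pmf n p) (btl_comp_pmf n L w)"

definition btl_edge :: "btl_sample \<Rightarrow> nat \<Rightarrow> nat \<Rightarrow> bool" where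
  "btl_edge \<omega> i j = (i \<noteq> j \<and> fst \<omega> (min i j, max i j))"

definition btl_y :: "nat \<Rightarrow> btl_sample \<Rightarrow> nat \<Rightarrow> nat \<Rightarrow> real" where
  "btl_y L \<omega> i j =
     (if i < j then (\<Sum>l<L. of_bool (snd \<omega> (i, j, l))) / real L
      else 1 - (\<Sum>l<L. of_bool (snd \<omega> (j, i, l))) / real L)"

definition btl_P :: "nat \<Rightarrow> nat \<Rightarrow> real \<Rightarrow> btl_sample \<Rightarrow> nat \<Rightarrow> nat \<Rightarrow> real" where
  "btl_P n L d \<omega> i j =
     (if i = j then 1 - (\<Sum>k\<in>{k. k < n \<and> btl_edge \<omega> i k}. btl_y L \<omega> i k) / d
      else if btl_edge \<omega> i j then btl_y L \<omega> i j / d else 0)"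

definition stationary :: "nat \<Rightarrow> (nat \<Rightarrow> nat \<Rightarrow> real) \<Rightarrow> (nat \<Rightarrow> real) \<Rightarrow> bool" where
  "stationary n P \<pi> \<longleftrightarrow> (\<Sum>i<n. \<pi> i) = 1 \<and> (\<forall>j<n. (\<Sum>i<n. \<pi> i * P i j) = \<pi> j)"

definition l2norm :: "nat \<Rightarrow> (nat \<Rightarrow> real) \<Rightarrow> real" where
  "l2norm n x = sqrt (\<Sum>i<n. (x i)\<^sup>2)"

definition pi_star :: "nat \<Rightarrow> (nat \<Rightarrow> real) \<Rightarrow> nat \<Rightarrow> real" where
  "pi_star n w i = w i / (\<Sum>k<n. w k)"

end

theory Submission
  imports Defs
begin

text \<open>
  Write \<open>a i j = A i j * \<pi>\<^sup>* i * y i j\<close> for the flow along an edge and \<open>h i = \<pi> i / \<pi>\<^sup>* i - 1\<close>.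
  The flow fails to be symmetric only through the imbalances \<open>b j = (\<Sum>k. a j k - a k j)\<close>, which are
  centred sums over the comparisons of item \<open>j\<close>. Testing stationarity against \<open>h\<close> gives the exact
  identity \<open>(\<Sum>i j. a i j * (h i - h j)\<^sup>2) = - 2 * (\<Sum>j. b j * h j) - (\<Sum>j. b j * (h j)\<^sup>2)\<close>.
  As \<open>a i j + a j i \<ge> A i j * min \<pi>\<^sup>*\<close> whatever the outcomes are, the left-hand side is at least of
  order \<open>1 / n\<close> times the Dirichlet energy of the graph, whose spectral gap is of order \<open>n p\<close>: all cuts
  have at least half their expected size (Chernoff and a union bound), all degrees are \<open>O(n p)\<close>, and
  Cheeger's inequality applies. Hence \<open>p * \<parallel>h\<parallel> = O(\<parallel>b\<parallel>)\<close> as soon as \<open>max \<bar>b j\<bar>\<close> is a small multiple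
  of \<open>p\<close>, which is Hoeffding's inequality. Finally \<open>\<parallel>b\<parallel>\<^sup>2 = O(p / L)\<close> without a logarithmic loss, by the
  exponential moments of squares of independent sub-Gaussian sums. The transition
  matrix enters only through the balance equations, from which \<open>d\<close> cancels.
\<close>

section \<open>Spectral gap and energy\<close>

text \<open>Co-area formula: \<open>max 0 (g i - g j)\<close> is the length of the set of levels
  \<open>t\<close> with \<open>g j \<le> t < g i\<close>. At a fixed level the weights that survive
  are exactly those crossing from the superlevel set of \<open>g\<close> to its complement, so the
  integrand is a cut. The weights may be negative; the intended ones are
  \<open>A i j - q\<close>.\<close>

lemma weighted_increments_nonneg_of_cuts:
  fixes c :: "'a \<Rightarrow> 'a \<Rightarrow> real" and g :: "'a \<Rightarrow> real"
  assumes fin: "finite V"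
    and cut: "\<And>S. S \<subseteq> V \<Longrightarrow> 0 \<le> (\<Sum>i\<in>S. \<Sum>j\<in>V - S. c i j)"
  shows "0 \<le> (\<Sum>i\<in>V. \<Sum>j\<in>V. c i j * max 0 (g i - g j))"
proof -
  define ind :: "'a \<Rightarrow> 'a \<Rightarrow> real \<Rightarrow> real" where "ind i j = indicator {g j..<g i}" for i j
  have int: "integrable lborel (ind i j)" for i j
    unfolding ind_def by (cases "g j \<le> g i") auto
  have val: "integral\<^sup>L lborel (ind i j) = max 0 (g i - g j)" for i j
    unfolding ind_def by (cases "g j \<le> g i") auto
  have "(\<Sum>i\<in>V. \<Sum>j\<in>V. c i j * max 0 (g i - g j)) = (\<integral>t. (\<Sum>i\<in>V. \<Sum>j\<in>V. c i j * ind i j t) \<partial>lborel)"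
    using int by (simp add: val Bochner_Integration.integral_sum)
  also have "\<dots> \<ge> 0"
  proof (rule Bochner_Integration.integral_nonneg)
    fix t
    define S where "S = {i\<in>V. t < g i}"
    have "(\<Sum>i\<in>V. \<Sum>j\<in>V. c i j * ind i j t)
        = (\<Sum>i\<in>V. \<Sum>j\<in>V. if i \<in> S then (if j \<in> V - S then c i j else 0) else 0)"
      by (intro sum.cong refl) (auto simp: S_def ind_def indicator_def)
    also have "\<dots> = (\<Sum>i\<in>V. if i \<in> S then (\<Sum>j\<in>V. if j \<in> V - S then c i j else 0) else 0)"
      by (intro sum.cong refl) auto
    also have "\<dots> = (\<Sum>i\<in>V \<inter> S. \<Sum>j\<in>V \<inter> (V - S). c i j)"
      using fin by (simp only: sum.inter_restrict)
    also have "\<dots> = (\<Sum>i\<in>S. \<Sum>j\<in>V - S. c i j)"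
      by (intro sum.cong) (auto simp: S_def)
    finally show "0 \<le> (\<Sum>i\<in>V. \<Sum>j\<in>V. c i j * ind i j t)"
      using cut[of S] by (auto simp: S_def)
  qed
  finally show ?thesis .
qed

text \<open>Intermediate value theorem between the minimum and the maximum of \<open>h\<close>. This
  centre replaces the median in Cheeger's argument.\<close>

lemma exists_signed_square_centre:
  fixes h :: "'a \<Rightarrow> real"
  assumes fin: "finite V"
  shows "\<exists>t. (\<Sum>i\<in>V. (h i - t) * \<bar>h i - t\<bar>) = 0"
proof (cases "V = {}")
  case False
  define F where "F t = (\<Sum>i\<in>V. (h i - t) * \<bar>h i - t\<bar>)" for t
  let ?a = "Min (h ` V)" and ?b = "Max (h ` V)"
  have ab: "?a \<le> h i" "h i \<le> ?b" if "i \<in> V" for i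
    using fin that by auto
  have "?a \<le> ?b"
    using False fin ab by (meson all_not_in_conv order_trans)
  moreover have "F ?b \<le> 0"
    unfolding F_def by (intro sum_nonpos mult_nonpos_nonneg) (use ab in auto)
  moreover have "0 \<le> F ?a"
    unfolding F_def by (intro sum_nonneg mult_nonneg_nonneg) (use ab in auto)
  moreover have "continuous_on {?a..?b} F"
    unfolding F_def by (intro continuous_intros)
  ultimately show ?thesis
    using IVT2'[of F ?b 0 ?a] by (auto simp: F_def)
qed simp

lemma abs_signed_square_diff_le:
  fixes x y :: real
  shows "\<bar>x * \<bar>x\<bar> - y * \<bar>y\<bar>\<bar> \<le> \<bar>x - y\<bar> * (\<bar>x\<bar> + \<bar>y\<bar>)"
proof -
  define X where "X = x * \<bar>x\<bar> - y * \<bar>y\<bar>"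
  \<comment> \<open>The first product is already of the desired form. In the second the roles are
    exchanged: \<open>x + y\<close> is bounded by the sum of absolute values and the difference of
    absolute values by \<open>\<bar>x - y\<bar>\<close>.\<close>
  have "2 * X = (x - y) * (\<bar>x\<bar> + \<bar>y\<bar>) + (x + y) * (\<bar>x\<bar> - \<bar>y\<bar>)"
    by (simp add: X_def algebra_simps)
  hence "\<bar>2 * X\<bar> \<le> \<bar>(x - y) * (\<bar>x\<bar> + \<bar>y\<bar>)\<bar> + \<bar>(x + y) * (\<bar>x\<bar> - \<bar>y\<bar>)\<bar>"
    by (metis abs_triangle_ineq)
  also have "\<dots> = \<bar>x - y\<bar> * (\<bar>x\<bar> + \<bar>y\<bar>) + \<bar>x + y\<bar> * \<bar>\<bar>x\<bar> - \<bar>y\<bar>\<bar>"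
    by (simp add: abs_mult)
  also have "\<bar>x + y\<bar> * \<bar>\<bar>x\<bar> - \<bar>y\<bar>\<bar> \<le> (\<bar>x\<bar> + \<bar>y\<bar>) * \<bar>x - y\<bar>"
    by (intro mult_mono) auto
  finally show ?thesis
    by (simp add: X_def[symmetric] mult.commute)
qed

lemma Cauchy_Schwarz_double_sum:
  fixes A u v :: "'a \<Rightarrow> 'a \<Rightarrow> real"
  assumes "\<And>i j. i \<in> V \<Longrightarrow> j \<in> V \<Longrightarrow> 0 \<le> A i j"
  shows "(\<Sum>i\<in>V. \<Sum>j\<in>V. A i j * (u i j * v i j))\<^sup>2
    \<le> (\<Sum>i\<in>V. \<Sum>j\<in>V. A i j * (u i j)\<^sup>2) * (\<Sum>i\<in>V. \<Sum>j\<in>V. A i j * (v i j)\<^sup>2)"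
proof -
  have "(\<Sum>x\<in>V \<times> V. (sqrt (A (fst x) (snd x)) * u (fst x) (snd x)) * (sqrt (A (fst x) (snd x)) * v (fst x) (snd x)))\<^sup>2
     \<le> (\<Sum>x\<in>V \<times> V. (sqrt (A (fst x) (snd x)) * u (fst x) (snd x))\<^sup>2) * (\<Sum>x\<in>V \<times> V. (sqrt (A (fst x) (snd x)) * v (fst x) (snd x))\<^sup>2)"
    by (rule Cauchy_Schwarz_ineq_sum)
  also have "(\<Sum>x\<in>V \<times> V. (sqrt (A (fst x) (snd x)) * u (fst x) (snd x)) * (sqrt (A (fst x) (snd x)) * v (fst x) (snd x)))
      = (\<Sum>i\<in>V. \<Sum>j\<in>V. A i j * (u i j * v i j))"
    using assms unfolding sum.cartesian_product case_prod_unfold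
    by (intro sum.cong refl) (auto simp: algebra_simps simp flip: real_sqrt_mult)
  also have "(\<Sum>x\<in>V \<times> V. (sqrt (A (fst x) (snd x)) * u (fst x) (snd x))\<^sup>2) = (\<Sum>i\<in>V. \<Sum>j\<in>V. A i j * (u i j)\<^sup>2)"
    using assms unfolding sum.cartesian_product case_prod_unfold
    by (intro sum.cong refl) (auto simp: power_mult_distrib)
  also have "(\<Sum>x\<in>V \<times> V. (sqrt (A (fst x) (snd x)) * v (fst x) (snd x))\<^sup>2) = (\<Sum>i\<in>V. \<Sum>j\<in>V. A i j * (v i j)\<^sup>2)"
    using assms unfolding sum.cartesian_product case_prod_unfold
    by (intro sum.cong refl) (auto simp: power_mult_distrib)
  finally show ?thesis .
qed

text \<open>Cheeger's argument. With \<open>t\<close> chosen such that the signed squares \<open>g i\<close> of \<open>f i = h i - t\<close> sum to zero,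
  the cut condition and the co-area formula give \<open>\<Sum> A i j \<bar>g i - g j\<bar> \<ge> q \<Sum> \<bar>g i - g j\<bar> \<ge> q |V| \<Sum> (f i)\<^sup>2\<close>,
  and Cauchy--Schwarz bounds the left-hand side in terms of the energy and the degrees.\<close>

lemma Cheeger_Poincare:
  fixes A :: "'a \<Rightarrow> 'a \<Rightarrow> real" and h :: "'a \<Rightarrow> real"
  assumes fin: "finite V" and q: "0 \<le> q"
    and A0: "\<And>i j. i \<in> V \<Longrightarrow> j \<in> V \<Longrightarrow> 0 \<le> A i j"
    and sym: "\<And>i j. i \<in> V \<Longrightarrow> j \<in> V \<Longrightarrow> A i j = A j i"
    and deg: "\<And>i. i \<in> V \<Longrightarrow> (\<Sum>j\<in>V. A i j) \<le> D"
    and cut: "\<And>S. S \<subseteq> V \<Longrightarrow> q * (real (card S) * real (card (V - S))) \<le> (\<Sum>i\<in>S. \<Sum>j\<in>V - S. A i j)"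
  shows "\<exists>t. (q * real (card V))\<^sup>2 * (\<Sum>i\<in>V. (h i - t)\<^sup>2)
    \<le> 4 * D * (\<Sum>i\<in>V. \<Sum>j\<in>V. A i j * (h i - h j)\<^sup>2)"
proof -
  obtain t where t: "(\<Sum>i\<in>V. (h i - t) * \<bar>h i - t\<bar>) = 0"
    using exists_signed_square_centre[OF fin] by blast
  define f where "f i = h i - t" for i
  define g where "g i = f i * \<bar>f i\<bar>" for i
  define N where "N = (\<Sum>i\<in>V. (f i)\<^sup>2)"
  define E where "E = (\<Sum>i\<in>V. \<Sum>j\<in>V. A i j * \<bar>f i - f j\<bar>\<^sup>2)"
  define n where "n = real (card V)"
  have N0: "N \<ge> 0" and E0: "E \<ge> 0"
    unfolding N_def E_def by (auto intro!: sum_nonneg mult_nonneg_nonneg A0)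
  have g0: "(\<Sum>i\<in>V. g i) = 0"
    using t by (simp add: g_def f_def)
  \<comment> \<open>The cut hypothesis says that the weights \<open>A i j - q\<close> have
    nonnegative cuts. Adding the mirrored sum, equal by symmetry of \<open>A\<close>, turns positive
    parts into absolute values.\<close>
  have "0 \<le> (\<Sum>i\<in>V. \<Sum>j\<in>V. (A i j - q) * max 0 (g i - g j))"
    using cut by (intro weighted_increments_nonneg_of_cuts fin) (auto simp: sum_subtractf mult_ac)
  moreover have "(\<Sum>i\<in>V. \<Sum>j\<in>V. (A i j - q) * max 0 (g i - g j)) = (\<Sum>i\<in>V. \<Sum>j\<in>V. (A i j - q) * max 0 (g j - g i))"
    by (subst sum.swap) (auto intro!: sum.cong simp: sym)
  moreover have "(\<Sum>i\<in>V. \<Sum>j\<in>V. (A i j - q) * \<bar>g i - g j\<bar>)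
     = (\<Sum>i\<in>V. \<Sum>j\<in>V. (A i j - q) * max 0 (g i - g j)) + (\<Sum>i\<in>V. \<Sum>j\<in>V. (A i j - q) * max 0 (g j - g i))"
    unfolding sum.distrib[symmetric] ring_distribs(1)[symmetric]
    by (intro sum.cong refl arg_cong2[where f="(*)"]) auto
  ultimately have "0 \<le> (\<Sum>i\<in>V. \<Sum>j\<in>V. (A i j - q) * \<bar>g i - g j\<bar>)"
    by linarith
  hence 1: "q * (\<Sum>i\<in>V. \<Sum>j\<in>V. \<bar>g i - g j\<bar>) \<le> (\<Sum>i\<in>V. \<Sum>j\<in>V. A i j * \<bar>g i - g j\<bar>)"
    by (simp add: left_diff_distrib sum_subtractf sum_distrib_left)
  \<comment> \<open>Here the choice of \<open>t\<close> is used: as the \<open>g j\<close> sum to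
    zero, the inner sum is \<open>n * g i\<close>, and \<open>\<bar>g i\<bar>\<close> is the square
    of \<open>f i\<close>.\<close>
  have "n * N = (\<Sum>i\<in>V. \<bar>\<Sum>j\<in>V. (g i - g j)\<bar>)"
    by (simp add: sum_subtractf g0 n_def N_def sum_distrib_left abs_mult power2_eq_square)
       (simp add: g_def abs_mult)
  also have "\<dots> \<le> (\<Sum>i\<in>V. \<Sum>j\<in>V. \<bar>g i - g j\<bar>)"
    by (intro sum_mono sum_abs)
  finally have 2: "q * (n * N) \<le> q * (\<Sum>i\<in>V. \<Sum>j\<in>V. \<bar>g i - g j\<bar>)"
    using q by (rule mult_left_mono)
  have 3: "(\<Sum>i\<in>V. \<Sum>j\<in>V. A i j * \<bar>g i - g j\<bar>) \<le> (\<Sum>i\<in>V. \<Sum>j\<in>V. A i j * (\<bar>f i - f j\<bar> * (\<bar>f i\<bar> + \<bar>f j\<bar>)))"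
    unfolding g_def by (intro sum_mono mult_left_mono abs_signed_square_diff_le A0)
  have 4: "(\<Sum>i\<in>V. \<Sum>j\<in>V. A i j * (\<bar>f i\<bar> + \<bar>f j\<bar>)\<^sup>2) \<le> 4 * D * N"
  proof -
    have s: "(\<bar>f i\<bar> + \<bar>f j\<bar>)\<^sup>2 \<le> 2 * ((f i)\<^sup>2 + (f j)\<^sup>2)" for i j
      using zero_le_power2[of "\<bar>f i\<bar> - \<bar>f j\<bar>"] by (simp add: power2_sum power2_diff)
    have d: "(\<Sum>i\<in>V. \<Sum>j\<in>V. A i j * (f i)\<^sup>2) \<le> D * N"
      unfolding N_def sum_distrib_right[symmetric] sum_distrib_left
      by (intro sum_mono mult_right_mono deg) auto
    have e: "(\<Sum>i\<in>V. \<Sum>j\<in>V. A i j * (f j)\<^sup>2) = (\<Sum>i\<in>V. \<Sum>j\<in>V. A i j * (f i)\<^sup>2)"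
      by (subst sum.swap) (auto intro!: sum.cong simp: sym)
    have "(\<Sum>i\<in>V. \<Sum>j\<in>V. A i j * (\<bar>f i\<bar> + \<bar>f j\<bar>)\<^sup>2) \<le> (\<Sum>i\<in>V. \<Sum>j\<in>V. A i j * (2 * ((f i)\<^sup>2 + (f j)\<^sup>2)))"
      by (intro sum_mono mult_left_mono s A0)
    also have "\<dots> = 2 * ((\<Sum>i\<in>V. \<Sum>j\<in>V. A i j * (f i)\<^sup>2) + (\<Sum>i\<in>V. \<Sum>j\<in>V. A i j * (f j)\<^sup>2))"
      by (simp add: sum.distrib sum_distrib_left algebra_simps)
    also have "\<dots> \<le> 2 * (D * N + D * N)"
      using d by (simp add: e)
    finally show ?thesis by simp
  qed
  have "(q * n * N)\<^sup>2 \<le> (\<Sum>i\<in>V. \<Sum>j\<in>V. A i j * (\<bar>f i - f j\<bar> * (\<bar>f i\<bar> + \<bar>f j\<bar>)))\<^sup>2"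
    using 1 2 3 q N0 by (intro power_mono) (auto simp: n_def mult_ac)
  also have "\<dots> \<le> E * (\<Sum>i\<in>V. \<Sum>j\<in>V. A i j * (\<bar>f i\<bar> + \<bar>f j\<bar>)\<^sup>2)"
    unfolding E_def by (rule Cauchy_Schwarz_double_sum) (rule A0)
  also have "\<dots> \<le> E * (4 * D * N)"
    by (intro mult_left_mono 4 E0)
  finally have 5: "N * ((q * n)\<^sup>2 * N) \<le> N * (4 * D * E)"
    by (simp add: power_mult_distrib power2_eq_square mult_ac)
  \<comment> \<open>One factor \<open>N\<close> is cancelled. If \<open>N = 0\<close>, only
    \<open>0 \<le> D\<close> is at issue, which the degree of any vertex supplies; with no vertices
    \<open>E\<close> vanishes.\<close>
  have "(q * n)\<^sup>2 * N \<le> 4 * D * E"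
  proof (cases "N = 0")
    case True
    have "0 \<le> 4 * D * E"
    proof (cases "V = {}")
      case False
      then obtain i where "i \<in> V" by blast
      hence "0 \<le> D" using deg[of i] sum_nonneg[of V "A i"] A0 by fastforce
      thus ?thesis using E0 by simp
    qed (simp add: E_def)
    thus ?thesis using True by simp
  qed (use 5 N0 in \<open>simp add: mult_le_cancel_left_pos\<close>)
  thus ?thesis
    by (intro exI[of _ t]) (simp add: N_def E_def n_def f_def)
qed

section \<open>Energy identity and the deterministic error bound\<close>

text \<open>Expanding the square gives \<open>Q + R - 2 * P\<close>. Stationarity expresses
  \<open>b j\<close> through \<open>h\<close>, and multiplying by \<open>h j\<close> yields
  \<open>P - Q\<close>; the definition of \<open>b\<close> multiplied by the square of
  \<open>h j\<close> yields \<open>Q - R\<close>.\<close>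

lemma reversible_perturbation_energy:
  fixes a :: "'a \<Rightarrow> 'a \<Rightarrow> real" and h b :: "'a \<Rightarrow> real"
  assumes b: "\<And>j. j \<in> V \<Longrightarrow> b j = (\<Sum>k\<in>V. a j k - a k j)"
    and st: "\<And>j. j \<in> V \<Longrightarrow> (\<Sum>i\<in>V. (1 + h i) * a i j) = (1 + h j) * (\<Sum>k\<in>V. a j k)"
  shows "(\<Sum>i\<in>V. \<Sum>j\<in>V. a i j * (h i - h j)\<^sup>2) = - 2 * (\<Sum>j\<in>V. b j * h j) - (\<Sum>j\<in>V. b j * (h j)\<^sup>2)"
proof -
  define P where "P = (\<Sum>j\<in>V. \<Sum>i\<in>V. a i j * h i * h j)"
  define Q where "Q = (\<Sum>j\<in>V. \<Sum>k\<in>V. a j k * (h j)\<^sup>2)"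
  define R where "R = (\<Sum>j\<in>V. \<Sum>k\<in>V. a k j * (h j)\<^sup>2)"
  have "b j * h j = (\<Sum>i\<in>V. a i j * h i * h j) - (\<Sum>k\<in>V. a j k * (h j)\<^sup>2)" if "j \<in> V" for j
  proof -
    have "b j = (\<Sum>i\<in>V. h i * a i j) - h j * (\<Sum>k\<in>V. a j k)"
      using st[OF that] by (simp add: b[OF that] sum_subtractf sum.distrib algebra_simps)
    hence "b j * h j = ((\<Sum>i\<in>V. h i * a i j) - h j * (\<Sum>k\<in>V. a j k)) * h j"
      by (rule arg_cong)
    also have "\<dots> = (\<Sum>i\<in>V. a i j * h i * h j) - (\<Sum>k\<in>V. a j k * (h j)\<^sup>2)"
      unfolding left_diff_distrib by (simp add: sum_distrib_left sum_distrib_right power2_eq_square mult_ac)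
    finally show ?thesis .
  qed
  hence 1: "(\<Sum>j\<in>V. b j * h j) = P - Q"
    by (simp add: P_def Q_def sum_subtractf)
  have 2: "(\<Sum>j\<in>V. b j * (h j)\<^sup>2) = Q - R"
    by (simp add: b Q_def R_def sum_subtractf sum_distrib_right left_diff_distrib)
  have "(\<Sum>i\<in>V. \<Sum>j\<in>V. a i j * (h i - h j)\<^sup>2)
      = Q + (\<Sum>i\<in>V. \<Sum>j\<in>V. a i j * (h j)\<^sup>2) - 2 * (\<Sum>i\<in>V. \<Sum>j\<in>V. a i j * h i * h j)"
    by (simp add: Q_def power2_diff algebra_simps sum.distrib sum_subtractf sum_distrib_left)
  also have "(\<Sum>i\<in>V. \<Sum>j\<in>V. a i j * (h j)\<^sup>2) = R"
    unfolding R_def by (rule sum.swap)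
  also have "(\<Sum>i\<in>V. \<Sum>j\<in>V. a i j * h i * h j) = P"
    unfolding P_def by (rule sum.swap)
  finally show ?thesis using 1 2 by simp
qed

text \<open>With weighted mean zero, \<open>t = 0\<close> minimises the weighted sum of squares
  around \<open>t\<close>; the weights are then compared with \<open>m\<close> and \<open>M\<close>.
  This removes the uncontrolled centre produced by Cheeger's argument.\<close>

lemma weighted_mean_zero_norm_le:
  fixes \<mu> h :: "'a \<Rightarrow> real"
  assumes m: "\<And>i. i \<in> V \<Longrightarrow> m \<le> \<mu> i" "\<And>i. i \<in> V \<Longrightarrow> \<mu> i \<le> M"
    and pos: "0 \<le> m" and mean: "(\<Sum>i\<in>V. \<mu> i * h i) = 0"
  shows "m * (\<Sum>i\<in>V. (h i)\<^sup>2) \<le> M * (\<Sum>i\<in>V. (h i - t)\<^sup>2)"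
proof -
  have "m * (\<Sum>i\<in>V. (h i)\<^sup>2) \<le> (\<Sum>i\<in>V. \<mu> i * (h i)\<^sup>2)"
    unfolding sum_distrib_left by (intro sum_mono mult_right_mono m) auto
  also have "\<dots> \<le> (\<Sum>i\<in>V. \<mu> i * (h i)\<^sup>2) - 2 * t * (\<Sum>i\<in>V. \<mu> i * h i) + (\<Sum>i\<in>V. \<mu> i * t\<^sup>2)"
    unfolding mean using order_trans[OF pos m(1)] by (simp add: sum_nonneg)
  also have "\<dots> = (\<Sum>i\<in>V. \<mu> i * (h i - t)\<^sup>2)"
    by (simp add: power2_diff algebra_simps sum.distrib sum_subtractf sum_distrib_left)
  also have "\<dots> \<le> M * (\<Sum>i\<in>V. (h i - t)\<^sup>2)"
    unfolding sum_distrib_left by (intro sum_mono mult_right_mono m) auto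
  finally show ?thesis .
qed

text \<open>The energy of \<open>h\<close> is bounded below by the spectral gap and above by the
  energy identity. Cauchy-Schwarz controls the linear term, and the bound on each
  \<open>\<bar>b j\<bar>\<close> makes the quadratic term small enough to be absorbed on the
  left.\<close>

lemma stationary_error_le_imbalance:
  fixes A y :: "nat \<Rightarrow> nat \<Rightarrow> real" and \<mu> \<pi> b :: "nat \<Rightarrow> real" and \<kappa> p :: real
  assumes n: "0 < n" and \<kappa>: "\<kappa> > 0" and p: "p > 0"
    and \<mu>l: "\<And>i. i < n \<Longrightarrow> 1 / (\<kappa> * real n) \<le> \<mu> i"
    and \<mu>u: "\<And>i. i < n \<Longrightarrow> \<mu> i \<le> \<kappa> / real n"
    and \<mu>1: "(\<Sum>i<n. \<mu> i) = 1" and \<pi>1: "(\<Sum>i<n. \<pi> i) = 1"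
    and A0: "\<And>i j. 0 \<le> A i j" and sym: "\<And>i j. A i j = A j i"
    and y0: "\<And>i j. 0 \<le> y i j"
    and y1: "\<And>i j. A i j * (y i j + y j i) = A i j"
    and deg: "\<And>i. i < n \<Longrightarrow> (\<Sum>j<n. A i j) \<le> 4 * real n * p"
    and cut: "\<And>S. S \<subseteq> {..<n} \<Longrightarrow> p / 2 * (real (card S) * real (card ({..<n} - S)))
               \<le> (\<Sum>i\<in>S. \<Sum>j\<in>{..<n} - S. A i j)"
    and st: "\<And>j. j < n \<Longrightarrow> (\<Sum>i<n. \<pi> i * (A i j * y i j)) = \<pi> j * (\<Sum>k<n. A j k * y j k)"
    and b: "\<And>j. j < n \<Longrightarrow> b j = (\<Sum>k<n. A j k * (\<mu> j * y j k - \<mu> k * y k j))"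
    and bsmall: "\<And>j. j < n \<Longrightarrow> \<bar>b j\<bar> \<le> p / (256 * \<kappa> ^ 3)"
  shows "p\<^sup>2 * (\<Sum>i<n. (\<pi> i - \<mu> i)\<^sup>2) \<le> (512 * \<kappa> ^ 4 / real n)\<^sup>2 * (\<Sum>i<n. (b i)\<^sup>2)"
proof -
  define h where "h i = \<pi> i / \<mu> i - 1" for i
  define a where "a i j = A i j * (\<mu> i * y i j)" for i j
  define H where "H = (\<Sum>i<n. (h i)\<^sup>2)"
  define B where "B = (\<Sum>i<n. (b i)\<^sup>2)"
  define E where "E = (\<Sum>i<n. \<Sum>j<n. A i j * (h i - h j)\<^sup>2)"
  have m0: "1 / (\<kappa> * real n) > 0" using \<kappa> n by simp
  have \<mu>0: "\<mu> i > 0" if "i < n" for i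
    using m0 \<mu>l[OF that] by linarith
  have \<pi>h: "\<pi> i = \<mu> i * (1 + h i)" if "i < n" for i
    using \<mu>0[OF that] by (simp add: h_def)
  have H0: "H \<ge> 0" and B0: "B \<ge> 0" by (auto simp: H_def B_def sum_nonneg)
  obtain t where t: "(p / 2 * real (card {..<n}))\<^sup>2 * (\<Sum>i<n. (h i - t)\<^sup>2) \<le> 4 * (4 * real n * p) * E"
    unfolding E_def
    using Cheeger_Poincare[of "{..<n}" "p/2" A "4 * real n * p" h] A0 sym deg cut p by auto
  define T where "T = (\<Sum>i<n. (h i - t)\<^sup>2)"
  \<comment> \<open>Cheeger with \<open>q = p / 2\<close> and \<open>D = 4 * real n * p\<close>
    gives \<open>(n * p)\<^sup>2 / 4 * T \<le> 16 * n * p * E\<close>, whence the constant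
    64.\<close>
  have "real n * p * (real n * p * T) \<le> real n * p * (64 * E)"
    using t unfolding T_def[symmetric] by (simp add: power2_eq_square field_simps)
  hence gap: "real n * p * T \<le> 64 * E"
    using n p by (simp add: mult_le_cancel_left_pos)
  have "(\<Sum>i<n. \<mu> i * h i) = 0"
  proof -
    have "(\<Sum>i<n. \<mu> i * h i) = (\<Sum>i<n. \<pi> i - \<mu> i)"
      by (intro sum.cong refl) (simp add: \<pi>h algebra_simps)
    thus ?thesis by (simp add: sum_subtractf \<mu>1 \<pi>1)
  qed
  hence "1 / (\<kappa> * real n) * H \<le> \<kappa> / real n * T"
    unfolding H_def T_def using \<mu>l \<mu>u m0 by (intro weighted_mean_zero_norm_le[where \<mu>=\<mu>]) auto
  hence HT: "H \<le> \<kappa>\<^sup>2 * T"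
    using n \<kappa> by (simp add: field_simps power2_eq_square)
  have low: "1 / (\<kappa> * real n) * E \<le> 2 * (\<Sum>i<n. \<Sum>j<n. a i j * (h i - h j)\<^sup>2)"
  proof -
    have aa: "1 / (\<kappa> * real n) * A i j \<le> a i j + a j i" if "i < n" "j < n" for i j
    proof -
      have "1 / (\<kappa> * real n) * A i j = A i j * (1 / (\<kappa> * real n) * y i j + 1 / (\<kappa> * real n) * y j i)"
        using y1[of i j] by (simp add: ring_distribs[symmetric] mult.assoc[symmetric] del: times_divide_eq_left)
          (simp add: mult_ac)
      also have "\<dots> \<le> A i j * (\<mu> i * y i j + \<mu> j * y j i)"
        by (intro mult_left_mono add_mono mult_right_mono \<mu>l that y0 A0)
      also have "\<dots> = a i j + a j i"
        by (simp add: a_def sym[of j i] ring_distribs)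
      finally show ?thesis .
    qed
    have "1 / (\<kappa> * real n) * E = (\<Sum>i<n. \<Sum>j<n. 1 / (\<kappa> * real n) * A i j * (h i - h j)\<^sup>2)"
      by (simp add: E_def sum_distrib_left mult_ac)
    also have "\<dots> \<le> (\<Sum>i<n. \<Sum>j<n. (a i j + a j i) * (h i - h j)\<^sup>2)"
      by (intro sum_mono mult_right_mono aa) auto
    also have "\<dots> = (\<Sum>i<n. \<Sum>j<n. a i j * (h i - h j)\<^sup>2) + (\<Sum>i<n. \<Sum>j<n. a j i * (h i - h j)\<^sup>2)"
      by (simp add: ring_distribs sum.distrib)
    also have "(\<Sum>i<n. \<Sum>j<n. a j i * (h i - h j)\<^sup>2) = (\<Sum>i<n. \<Sum>j<n. a i j * (h i - h j)\<^sup>2)"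
      by (subst sum.swap) (simp add: power2_commute)
    finally show ?thesis by simp
  qed
  have id: "(\<Sum>i<n. \<Sum>j<n. a i j * (h i - h j)\<^sup>2) = - 2 * (\<Sum>j<n. b j * h j) - (\<Sum>j<n. b j * (h j)\<^sup>2)"
  proof (rule reversible_perturbation_energy)
    fix j assume "j \<in> {..<n}"
    hence j: "j < n" by simp
    show "b j = (\<Sum>k<n. a j k - a k j)"
      by (simp add: b[OF j] a_def sym[of _ j] right_diff_distrib)
    have "(\<Sum>i<n. (1 + h i) * a i j) = (\<Sum>i<n. \<pi> i * (A i j * y i j))"
      by (intro sum.cong refl) (simp add: \<pi>h a_def mult_ac)
    also have "\<dots> = \<pi> j * (\<Sum>k<n. A j k * y j k)" by (rule st[OF j])
    also have "\<dots> = (1 + h j) * (\<Sum>k<n. a j k)"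
      by (simp add: \<pi>h[OF j] a_def sum_distrib_left mult_ac)
    finally show "(\<Sum>i<n. (1 + h i) * a i j) = (1 + h j) * (\<Sum>k<n. a j k)" .
  qed
  have cs: "- (\<Sum>j<n. b j * h j) \<le> sqrt B * sqrt H"
  proof -
    have "(\<Sum>j<n. b j * h j)\<^sup>2 \<le> B * H"
      unfolding B_def H_def by (rule Cauchy_Schwarz_ineq_sum)
    hence "\<bar>\<Sum>j<n. b j * h j\<bar> \<le> sqrt (B * H)"
      by (metis real_sqrt_abs real_sqrt_le_iff)
    thus ?thesis by (simp add: real_sqrt_mult)
  qed
  have bq: "- (\<Sum>j<n. b j * (h j)\<^sup>2) \<le> p / (256 * \<kappa> ^ 3) * H"
  proof -
    have "- (\<Sum>j<n. b j * (h j)\<^sup>2) = (\<Sum>j<n. (- b j) * (h j)\<^sup>2)"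
      by (simp add: sum_negf)
    also have "\<dots> \<le> (\<Sum>j<n. p / (256 * \<kappa> ^ 3) * (h j)\<^sup>2)"
      using bsmall by (intro sum_mono mult_right_mono) (auto simp: abs_le_iff)
    finally show ?thesis by (simp add: H_def sum_distrib_left)
  qed
  have "p * H / (64 * \<kappa> ^ 3) \<le> 1 / (\<kappa> * real n) * E"
  proof -
    have "p * H \<le> p * (\<kappa>\<^sup>2 * T)" using HT p by simp
    also have "\<dots> = \<kappa>\<^sup>2 * (real n * p * T) / real n" using n by simp
    also have "\<dots> \<le> \<kappa>\<^sup>2 * (64 * E) / real n"
      using gap by (intro divide_right_mono mult_left_mono) auto
    finally have "p * H / (64 * \<kappa> ^ 3) \<le> \<kappa>\<^sup>2 * (64 * E) / real n / (64 * \<kappa> ^ 3)"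
      using \<kappa> by (intro divide_right_mono) auto
    also have "\<dots> = 1 / (\<kappa> * real n) * E"
      using \<kappa> n by (simp add: power2_eq_square power3_eq_cube field_simps)
    finally show ?thesis .
  qed
  also have "\<dots> \<le> 4 * (sqrt B * sqrt H) + 2 * (p / (256 * \<kappa> ^ 3) * H)"
    using low id cs bq by linarith
  \<comment> \<open>The threshold 256 is chosen so that the quadratic term costs
    \<open>p * H / (128 * \<kappa> ^ 3)\<close>, half of the left-hand side. The remaining half
    against \<open>4 * (sqrt B * sqrt H)\<close> gives the factor 512.\<close>
  finally have "p * H / (64 * \<kappa> ^ 3) - 2 * (p / (256 * \<kappa> ^ 3) * H) \<le> 4 * (sqrt B * sqrt H)"
    by linarith
  hence "p * H \<le> 512 * \<kappa> ^ 3 * (sqrt B * sqrt H)"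
    using \<kappa> by (simp add: field_simps)
  hence "sqrt H * (p * sqrt H) \<le> sqrt H * (512 * \<kappa> ^ 3 * sqrt B)"
    using H0 by (simp add: mult_ac)
  hence "p * sqrt H \<le> 512 * \<kappa> ^ 3 * sqrt B"
  proof (cases "H = 0")
    case False
    hence "sqrt H > 0" using H0 by simp
    with \<open>sqrt H * _ \<le> _\<close> show ?thesis by (rule mult_left_le_imp_le)
  qed (use B0 \<kappa> in simp)
  hence "(p * sqrt H)\<^sup>2 \<le> (512 * \<kappa> ^ 3 * sqrt B)\<^sup>2"
    using p H0 by (intro power_mono) auto
  hence fin: "p\<^sup>2 * H \<le> (512 * \<kappa> ^ 3)\<^sup>2 * B"
    using H0 B0 by (simp add: power_mult_distrib)
  \<comment> \<open>Returning from relative to absolute errors costs the largest entry of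
    \<open>\<mu>\<close>, which raises the power of \<open>\<kappa>\<close> from 3 to 4.\<close>
  have "(\<Sum>i<n. (\<pi> i - \<mu> i)\<^sup>2) \<le> (\<kappa> / real n)\<^sup>2 * H"
    unfolding H_def sum_distrib_left
  proof (rule sum_mono)
    fix i assume "i \<in> {..<n}"
    hence i: "i < n" by simp
    have "\<pi> i - \<mu> i = \<mu> i * h i"
      by (simp add: \<pi>h[OF i] algebra_simps)
    hence "(\<pi> i - \<mu> i)\<^sup>2 = (\<mu> i)\<^sup>2 * (h i)\<^sup>2"
      by (simp add: power_mult_distrib)
    also have "\<dots> \<le> (\<kappa> / real n)\<^sup>2 * (h i)\<^sup>2"
      using \<mu>u[OF i] \<mu>0[OF i] by (intro mult_right_mono power_mono) auto
    finally show "(\<pi> i - \<mu> i)\<^sup>2 \<le> (\<kappa> / real n)\<^sup>2 * (h i)\<^sup>2" .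
  qed
  hence "p\<^sup>2 * (\<Sum>i<n. (\<pi> i - \<mu> i)\<^sup>2) \<le> p\<^sup>2 * ((\<kappa> / real n)\<^sup>2 * H)"
    by (intro mult_left_mono) auto
  also have "\<dots> = (\<kappa> / real n)\<^sup>2 * (p\<^sup>2 * H)" by (simp only: mult_ac)
  also have "\<dots> \<le> (\<kappa> / real n)\<^sup>2 * ((512 * \<kappa> ^ 3)\<^sup>2 * B)"
    by (intro mult_left_mono fin) auto
  also have "\<dots> = (512 * \<kappa> ^ 4 / real n)\<^sup>2 * B"
  proof -
    have "512 * \<kappa> ^ 4 / real n = (\<kappa> / real n) * (512 * \<kappa> ^ 3)"
      using power_Suc[of \<kappa> 3] by simp
    thus ?thesis by (simp only: power_mult_distrib mult.assoc)
  qed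
  finally show ?thesis by (simp only: B_def)
qed

section \<open>Concentration for Bernoulli sums\<close>

lemma integrable_measure_pmf_bounded:
  fixes f :: "'a \<Rightarrow> real"
  assumes "\<And>x. \<bar>f x\<bar> \<le> B"
  shows "integrable (measure_pmf M) f"
  by (rule measure_pmf.integrable_const_bound[where B = B]) (use assms in auto)

lemma prob_pmf_Markov:
  fixes f :: "'a \<Rightarrow> real"
  assumes "integrable (measure_pmf M) f" "\<And>x. 0 \<le> f x" "0 < c"
  shows "measure_pmf.prob M {x. c \<le> f x} \<le> measure_pmf.expectation M f / c"
  using integral_Markov_inequality_measure[of "measure_pmf M" f "{}" c] assms by simp

text \<open>Hoeffding's inequality, with the threshold placed on the square and scaled by a variance
  proxy \<open>V\<close> so that the tail is \<open>2 * exp (- s)\<close> whatever the coefficients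
  are. This form can be summed over layers directly.\<close>

lemma bernoulli_sum_Hoeffding:
  fixes c q :: "'a \<Rightarrow> real"
  assumes fin: "finite I" and K: "K \<subseteq> I" and q: "\<And>t. t \<in> I \<Longrightarrow> 0 \<le> q t \<and> q t \<le> 1"
    and V: "(\<Sum>t\<in>K. (c t)\<^sup>2) \<le> V" "V > 0" and s: "s \<ge> 0"
  shows "measure_pmf.prob (Pi_pmf I False (\<lambda>t. bernoulli_pmf (q t)))
      {Y. s * V / 2 \<le> (\<Sum>t\<in>K. c t * (of_bool (Y t) - q t))\<^sup>2} \<le> 2 * exp (- s)"
    (is "measure_pmf.prob ?M ?S \<le> _")
\<comment> \<open>Degenerate cases are split off because Hoeffding's exponent divides by the sum of
  squares: for \<open>s = 0\<close> the bound exceeds 1, and for vanishing coefficients the sum is 0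
  below a positive threshold.\<close>
proof (cases "s = 0 \<or> (\<Sum>t\<in>K. (c t)\<^sup>2) = 0")
  case True
  show ?thesis
  proof (cases "s = 0")
    case True
    thus ?thesis using measure_pmf.prob_le_1[of ?M ?S] by (simp del: measure_pmf.prob_le_1)
  next
    case False
    have "finite K" using fin K finite_subset by blast
    with \<open>s = 0 \<or> _\<close> False have "\<forall>t\<in>K. c t = 0" by (simp add: sum_nonneg_eq_0_iff)
    hence "(\<Sum>t\<in>K. c t * (of_bool (Y t) - q t)) = 0" for Y by simp
    moreover have "s * V > 0" using False s V by simp
    ultimately show ?thesis by simp
  qed
next
  case False
  have finK: "finite K" using fin K finite_subset by blast
  define X where "X t Y = c t * (of_bool (Y t) - q t)" for t and Y :: "'a \<Rightarrow> bool"
  \<comment> \<open>\<open>a t\<close> is the left end of the range of \<open>X t\<close>; the range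
    has width \<open>\<bar>c t\<bar>\<close> for either sign of \<open>c t\<close>.\<close>
  define a where "a t = (if c t \<ge> 0 then - c t * q t else c t * (1 - q t))" for t
  have pos: "0 < (\<Sum>t\<in>K. (c t)\<^sup>2)"
    using False by (simp add: sum_nonneg less_le)
  have ex: "measure_pmf.expectation ?M (X t) = 0" if "t \<in> K" for t
  proof -
    have tI: "t \<in> I" using that K by blast
    have "measure_pmf.expectation ?M (X t)
        = measure_pmf.expectation (map_pmf (\<lambda>f. f t) ?M) (\<lambda>v. c t * (of_bool v - q t))"
      by (subst integral_map_pmf) (simp add: X_def[abs_def])
    also have "map_pmf (\<lambda>f. f t) ?M = bernoulli_pmf (q t)"
      using tI by (simp add: Pi_pmf_component fin)
    also have "measure_pmf.expectation (bernoulli_pmf (q t)) (\<lambda>v. c t * (of_bool v - q t)) = 0"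
      using q[OF tI] by (simp add: algebra_simps)
    finally show ?thesis .
  qed
  interpret Hoeffding_ineq "measure_pmf ?M" K X a "\<lambda>t. a t + \<bar>c t\<bar>" "\<Sum>t\<in>K. measure_pmf.expectation ?M (X t)"
  proof unfold_locales
    show "finite K" by (rule finK)
    show "prob_space.indep_vars (measure_pmf ?M) (\<lambda>_. borel) X K"
      unfolding X_def
      by (rule prob_space.indep_vars_compose2[OF measure_pmf.prob_space_axioms prob_space.indep_vars_subset[OF measure_pmf.prob_space_axioms indep_vars_Pi_pmf[OF fin] K]]) auto
    fix t assume "t \<in> K"
    hence "0 \<le> q t" "q t \<le> 1" using q K by auto
    hence "X t Y \<in> {a t..a t + \<bar>c t\<bar>}" for Y
      by (cases "Y t") (auto simp: X_def a_def algebra_simps mult_nonneg_nonneg mult_nonpos_nonneg)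
    thus "AE Y in measure_pmf ?M. X t Y \<in> {a t..a t + \<bar>c t\<bar>}" by simp
  qed auto
  define \<epsilon> where "\<epsilon> = sqrt (s * V / 2)"
  have \<epsilon>: "\<epsilon> \<ge> 0" "\<epsilon>\<^sup>2 = s * V / 2" using s V by (auto simp: \<epsilon>_def)
  have "?S = {Y. \<epsilon> \<le> \<bar>\<Sum>t\<in>K. X t Y\<bar>}"
    unfolding X_def \<epsilon>_def by (auto simp: real_le_lsqrt real_sqrt_le_iff simp flip: real_sqrt_abs)
  hence "measure_pmf.prob ?M ?S \<le> 2 * exp (- 2 * \<epsilon>\<^sup>2 / (\<Sum>t\<in>K. (c t)\<^sup>2))"
    using Hoeffding_ineq_abs_ge[OF \<epsilon>(1)] pos by (simp add: ex)
  also have "- 2 * \<epsilon>\<^sup>2 / (\<Sum>t\<in>K. (c t)\<^sup>2) \<le> - s"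
    using pos mult_left_mono[OF V(1) s] \<epsilon>(2) by (simp add: field_simps)
  finally show ?thesis by simp
qed

lemma abs_bernoulli_sum_le:
  fixes c q :: "'a \<Rightarrow> real"
  assumes q: "\<And>t. t \<in> K \<Longrightarrow> 0 \<le> q t \<and> q t \<le> 1"
  shows "\<bar>\<Sum>t\<in>K. c t * (of_bool (Y t) - q t)\<bar> \<le> (\<Sum>t\<in>K. \<bar>c t\<bar>)"
proof (rule order_trans[OF sum_abs], rule sum_mono)
  fix t assume "t \<in> K"
  hence "\<bar>of_bool (Y t) - q t\<bar> \<le> 1" using q[of t] by (cases "Y t") auto
  hence "\<bar>c t\<bar> * \<bar>of_bool (Y t) - q t\<bar> \<le> \<bar>c t\<bar> * 1" by (intro mult_left_mono) auto
  thus "\<bar>c t * (of_bool (Y t) - q t)\<bar> \<le> \<bar>c t\<bar>" by (simp add: abs_mult)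
qed

text \<open>Layer-cake argument: the exponential is cut into layers on which
  \<open>2 * R Y / V\<close> lies between \<open>k\<close> and \<open>k + 1\<close>. Layer
  \<open>k\<close> contributes at most \<open>exp ((k + 1) / 2)\<close> with probability at most
  \<open>2 * exp (- k)\<close>, so the layers sum to a geometric series.\<close>

lemma bernoulli_sum_exp_square:
  fixes c q :: "'a \<Rightarrow> real"
  assumes fin: "finite I" and K: "K \<subseteq> I" and q: "\<And>t. t \<in> I \<Longrightarrow> 0 \<le> q t \<and> q t \<le> 1"
    and V: "(\<Sum>t\<in>K. (c t)\<^sup>2) \<le> V" "V > 0"
  defines "M \<equiv> Pi_pmf I False (\<lambda>t. bernoulli_pmf (q t))"
    and "F \<equiv> \<lambda>Y. exp ((\<Sum>t\<in>K. c t * (of_bool (Y t) - q t))\<^sup>2 / V)"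
  shows "integrable (measure_pmf M) F" and "measure_pmf.expectation M F \<le> exp 3"
proof -
  define R where "R Y = (\<Sum>t\<in>K. c t * (of_bool (Y t) - q t))\<^sup>2" for Y :: "'a \<Rightarrow> bool"
  define B where "B = (\<Sum>t\<in>K. \<bar>c t\<bar>)\<^sup>2"
  have RB: "R Y \<le> B" for Y
    unfolding R_def B_def using abs_bernoulli_sum_le[of K q c Y] q K
    by (intro power2_le_iff_abs_le[THEN iffD2]) (auto simp: sum_nonneg)
  have FR: "F Y = exp (R Y / V)" for Y by (simp add: F_def R_def)
  have "\<bar>F Y\<bar> \<le> exp (B / V)" for Y
    using RB[of Y] V by (simp add: FR divide_right_mono)
  thus int: "integrable (measure_pmf M) F"
    by (rule integrable_measure_pmf_bounded)
  \<comment> \<open>The sum is bounded, so \<open>N\<close> layers cover all outcomes and only a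
    finite sum has to be integrated.\<close>
  obtain N :: nat where N: "2 * B / V < real N" using reals_Archimedean2 by blast
  define A where "A k = {Y. real k * V / 2 \<le> R Y}" for k :: nat
  have layer: "F Y \<le> (\<Sum>k<N. exp ((real k + 1) / 2) * indicator (A k) Y)" for Y
  proof -
    define k where "k = nat \<lfloor>2 * R Y / V\<rfloor>"
    have R0: "0 \<le> 2 * R Y / V" using V by (simp add: R_def)
    have k: "real k \<le> 2 * R Y / V" "2 * R Y / V < real k + 1"
      using R0 by (auto simp: k_def)
    have "2 * R Y / V \<le> 2 * B / V" using RB[of Y] V by (simp add: divide_right_mono)
    hence kN: "k < N" using k N by linarith
    have "F Y \<le> exp ((real k + 1) / 2)" using k(2) by (simp add: FR mult.commute)
    also have "\<dots> = exp ((real k + 1) / 2) * indicator (A k) Y"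
      using k(1) V by (simp add: A_def field_simps)
    also have "\<dots> \<le> (\<Sum>k<N. exp ((real k + 1) / 2) * indicator (A k) Y)"
      using kN by (intro member_le_sum) auto
    finally show ?thesis .
  qed
  \<comment> \<open>Common ratio of the layer bounds. From \<open>x \<le> 2 / 3\<close> the series
    is at most 3, and the total \<open>6 * exp (1 / 2)\<close> stays below
    \<open>exp 3\<close>.\<close>
  define x :: real where "x = exp (- 1 / 2)"
  have x0: "0 < x" by (simp add: x_def)
  have "1 + 1 / 2 \<le> exp (1 / 2 :: real)" by (rule exp_ge_add_one_self)
  hence x1: "x \<le> 2 / 3" by (simp add: x_def exp_minus field_simps)
  have "measure_pmf.expectation M F \<le> measure_pmf.expectation M (\<lambda>Y. \<Sum>k<N. exp ((real k + 1) / 2) * indicator (A k) Y)"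
    using layer int
    by (intro integral_mono Bochner_Integration.integrable_sum integrable_mult_right)
      (auto simp: measure_pmf.emeasure_eq_measure less_top[symmetric])
  also have "\<dots> = (\<Sum>k<N. exp ((real k + 1) / 2) * measure_pmf.prob M (A k))"
    by (subst Bochner_Integration.integral_sum)
       (auto simp: measure_pmf.emeasure_eq_measure less_top[symmetric])
  also have "\<dots> \<le> (\<Sum>k<N. exp ((real k + 1) / 2) * (2 * exp (- real k)))"
    unfolding A_def R_def M_def by (intro sum_mono mult_left_mono bernoulli_sum_Hoeffding assms) auto
  also have "\<dots> = 2 * exp (1 / 2) * (\<Sum>k<N. x ^ k)"
    unfolding sum_distrib_left x_def exp_of_nat_mult[symmetric]
    by (intro sum.cong refl) (simp add: exp_add[symmetric] mult_ac field_simps)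
  also have "(\<Sum>k<N. x ^ k) \<le> 3"
  proof -
    have "(\<Sum>k<N. x ^ k) = (1 - x ^ N) / (1 - x)"
      using x1 by (subst sum_gp_strict) auto
    also have "\<dots> \<le> 1 / (1 - x)" using x0 x1 by (intro divide_right_mono) auto
    also have "\<dots> \<le> 3" using x1 by (simp add: field_simps)
    finally show ?thesis .
  qed
  also have "2 * exp (1 / 2) * 3 \<le> (exp 3 :: real)"
  proof -
    have "exp (1/2) * 6 \<le> exp (1/2) * exp (5/2 :: real)"
      using exp_lower_Taylor_quadratic[of "5/2"] by (intro mult_left_mono) (auto simp: power2_eq_square)
    also have "\<dots> = exp 3" by (simp add: exp_add[symmetric])
    finally show ?thesis by simp
  qed
  finally show "measure_pmf.expectation M F \<le> exp 3" by simp
qed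

text \<open>Sums over disjoint blocks are independent, so the exponential moment of the normalised
  total is a product and at most \<open>exp (3 * card J)\<close>. Markov at level
  \<open>exp (8 * card J)\<close> leaves the exponent -5. A union bound over blocks would instead
  lose a logarithm.\<close>

lemma bernoulli_block_sums_square_tail:
  fixes c q :: "'a \<Rightarrow> real" and K :: "'b \<Rightarrow> 'a set"
  assumes fin: "finite I" "finite J" and K: "\<And>i. i \<in> J \<Longrightarrow> K i \<subseteq> I" and disj: "disjoint_family_on K J"
    and q: "\<And>t. t \<in> I \<Longrightarrow> 0 \<le> q t \<and> q t \<le> 1"
    and V: "\<And>i. i \<in> J \<Longrightarrow> (\<Sum>t\<in>K i. (c t)\<^sup>2) \<le> V" "V > 0"
  shows "measure_pmf.prob (Pi_pmf I False (\<lambda>t. bernoulli_pmf (q t)))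
      {Y. 8 * real (card J) * V \<le> (\<Sum>i\<in>J. (\<Sum>t\<in>K i. c t * (of_bool (Y t) - q t))\<^sup>2)} \<le> exp (- 5 * real (card J))"
    (is "measure_pmf.prob ?M ?S \<le> _")
proof -
  define F where "F i Y = exp ((\<Sum>t\<in>K i. c t * (of_bool (Y t) - q t))\<^sup>2 / V)" for i and Y :: "'a \<Rightarrow> bool"
  have ind: "prob_space.indep_vars (measure_pmf ?M) (\<lambda>_. borel) F J"
  proof -
    have "prob_space.indep_vars (measure_pmf ?M) (\<lambda>_. borel) (\<lambda>t Y. c t * (of_bool (Y t) - q t)) I"
      by (rule prob_space.indep_vars_compose2[OF measure_pmf.prob_space_axioms indep_vars_Pi_pmf[OF fin(1)]]) auto
    \<comment> \<open>Independence passes from coordinates to blocks: the restrictions to disjoint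
      index sets are independent, and each block sum is a measurable function of its own
      restriction.\<close>
    from prob_space.indep_vars_restrict[OF measure_pmf.prob_space_axioms this K disj]
    have "prob_space.indep_vars (measure_pmf ?M) (\<lambda>j. PiM (K j) (\<lambda>_. borel))
       (\<lambda>j Y. restrict (\<lambda>t. c t * (of_bool (Y t) - q t)) (K j)) J" .
    hence "prob_space.indep_vars (measure_pmf ?M) (\<lambda>_. borel)
       (\<lambda>j Y. exp ((\<Sum>t\<in>K j. restrict (\<lambda>t. c t * (of_bool (Y t) - q t)) (K j) t)\<^sup>2 / V)) J"
      by (rule prob_space.indep_vars_compose2[OF measure_pmf.prob_space_axioms, where Y = "\<lambda>j f. exp ((\<Sum>t\<in>K j. f t)\<^sup>2 / V)"]) measurable
    thus ?thesis unfolding F_def by simp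
  qed
  have intF: "integrable (measure_pmf ?M) (F i)" and exF: "measure_pmf.expectation ?M (F i) \<le> exp 3" if "i \<in> J" for i
    unfolding F_def using bernoulli_sum_exp_square[OF fin(1) K[OF that] q V(1)[OF that] V(2)] by auto
  define G where "G Y = (\<Prod>i\<in>J. F i Y)" for Y
  have "integrable (measure_pmf ?M) G"
    unfolding G_def by (rule prob_space.indep_vars_integrable[OF measure_pmf.prob_space_axioms fin(2) ind intF])
  hence "measure_pmf.prob ?M {Y. exp (8 * real (card J)) \<le> G Y} \<le> measure_pmf.expectation ?M G / exp (8 * real (card J))"
    by (rule prob_pmf_Markov) (auto simp: G_def F_def prod_nonneg)
  also have "{Y. exp (8 * real (card J)) \<le> G Y} = ?S"
    using V(2) by (simp add: G_def F_def exp_sum[OF fin(2), symmetric] sum_divide_distrib[symmetric] field_simps)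
  also have "measure_pmf.expectation ?M G = (\<Prod>i\<in>J. measure_pmf.expectation ?M (F i))"
    unfolding G_def by (rule prob_space.indep_vars_lebesgue_integral[OF measure_pmf.prob_space_axioms fin(2) ind intF])
  also have "\<dots> \<le> (\<Prod>i\<in>J. exp 3)"
    by (intro prod_mono conjI exF integral_nonneg_AE) (auto simp: F_def)
  also have "\<dots> = exp (3 * real (card J))"
    by (simp add: exp_of_nat_mult[symmetric] mult.commute)
  finally show ?thesis
    by (simp add: divide_right_mono exp_diff[symmetric])
qed

section \<open>Chernoff bounds for edge counts\<close>

lemma bernoulli_count_mgf:
  fixes p s :: real
  assumes fin: "finite I" and T: "T \<subseteq> I" and p: "0 \<le> p" "p \<le> 1"
  shows "measure_pmf.expectation (Pi_pmf I False (\<lambda>_. bernoulli_pmf p)) (\<lambda>G. exp (s * (\<Sum>e\<in>T. of_bool (G e))))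
    \<le> exp (p * real (card T) * (exp s - 1))"
proof -
  \<comment> \<open>Coordinates outside \<open>T\<close> get the factor 1, so that the product runs
    over all of \<open>I\<close> and its expectation factorises.\<close>
  define f where "f e v = (if e \<in> T then exp (s * of_bool v) else 1)" for e :: 'a and v :: bool
  have finT: "finite T" using fin T finite_subset by blast
  have "exp (s * (\<Sum>e\<in>T. of_bool (G e))) = (\<Prod>e\<in>I. f e (G e))" for G :: "'a \<Rightarrow> bool"
    unfolding f_def sum_distrib_left exp_sum[OF finT] using fin T
    by (simp add: prod.inter_restrict[symmetric] Int_absorb1 del: sum_of_bool_eq)
  hence "measure_pmf.expectation (Pi_pmf I False (\<lambda>_. bernoulli_pmf p)) (\<lambda>G. exp (s * (\<Sum>e\<in>T. of_bool (G e))))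
     = (\<Prod>e\<in>I. measure_pmf.expectation (bernoulli_pmf p) (f e))"
    using fin by (simp, subst expectation_prod_Pi_pmf) (auto simp: f_def integrable_measure_pmf_finite)
  also have "\<dots> = (\<Prod>e\<in>I. if e \<in> T then 1 + p * (exp s - 1) else 1)"
    using p by (intro prod.cong refl) (auto simp: f_def algebra_simps)
  also have "\<dots> = (1 + p * (exp s - 1)) ^ card T"
    using fin T by (simp add: prod.inter_restrict[symmetric] Int_absorb1)
  also have "\<dots> \<le> exp (p * (exp s - 1)) ^ card T"
  proof (intro power_mono exp_ge_add_one_self)
    \<comment> \<open>For negative \<open>s\<close> the base is not obviously nonnegative; as a
      convex combination of 1 and \<open>exp s\<close> it is.\<close>
    have "0 \<le> (1 - p) + p * exp s" using p by simp
    thus "0 \<le> 1 + p * (exp s - 1)" by (simp add: algebra_simps)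
  qed
  also have "\<dots> = exp (p * real (card T) * (exp s - 1))"
    by (simp add: exp_of_nat_mult[symmetric] mult_ac)
  finally show ?thesis .
qed

text \<open>The threshold is put on \<open>s\<close> times the count, so that one statement serves
  both tails: \<open>s = 1\<close> for large counts and \<open>s = -1\<close> for small
  ones.\<close>

lemma bernoulli_count_Chernoff:
  fixes p s x :: real
  assumes fin: "finite I" and T: "T \<subseteq> I" and p: "0 \<le> p" "p \<le> 1"
  shows "measure_pmf.prob (Pi_pmf I False (\<lambda>_. bernoulli_pmf p)) {G. x \<le> s * (\<Sum>e\<in>T. of_bool (G e))}
    \<le> exp (p * real (card T) * (exp s - 1) - x)" (is "measure_pmf.prob ?M _ \<le> _")
proof -
  define f where "f G = exp (s * (\<Sum>e\<in>T. of_bool (G e)))" for G :: "'a \<Rightarrow> bool"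
  have "\<bar>f G\<bar> \<le> exp (\<bar>s\<bar> * real (card T))" for G
  proof -
    have "(\<Sum>e\<in>T. of_bool (G e)) \<le> (\<Sum>e\<in>T. 1 :: real)" by (intro sum_mono) auto
    hence "s * (\<Sum>e\<in>T. of_bool (G e)) \<le> \<bar>s\<bar> * real (card T)"
      by (intro mult_mono) (auto simp: sum_nonneg)
    thus ?thesis by (simp add: f_def)
  qed
  hence "integrable (measure_pmf ?M) f" by (rule integrable_measure_pmf_bounded)
  hence "measure_pmf.prob ?M {G. exp x \<le> f G} \<le> measure_pmf.expectation ?M f / exp x"
    by (rule prob_pmf_Markov) (auto simp: f_def)
  also have "\<dots> \<le> exp (p * real (card T) * (exp s - 1)) / exp x"
    unfolding f_def by (intro divide_right_mono bernoulli_count_mgf assms) auto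
  finally show ?thesis by (simp add: f_def exp_diff)
qed

lemma bernoulli_count_upper_tail:
  fixes p :: real
  assumes fin: "finite I" and T: "T \<subseteq> I" and p: "0 \<le> p" "p \<le> 1" and \<mu>: "p * real (card T) \<le> \<mu>"
  shows "measure_pmf.prob (Pi_pmf I False (\<lambda>_. bernoulli_pmf p)) {G. 4 * \<mu> \<le> (\<Sum>e\<in>T. of_bool (G e))}
    \<le> exp (- 2 * \<mu>)"
proof -
  have "p * real (card T) * (exp 1 - 1) \<le> \<mu> * 2"
    using exp_le order_trans[OF _ \<mu>, of 0] p \<mu> by (intro mult_mono) auto
  thus ?thesis
    using bernoulli_count_Chernoff[OF fin T p, of "4 * \<mu>" 1] by (force intro: order_trans)
qed

lemma bernoulli_count_lower_tail:
  fixes p :: real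
  assumes fin: "finite I" and T: "T \<subseteq> I" and p: "0 \<le> p" "p \<le> 1"
  shows "measure_pmf.prob (Pi_pmf I False (\<lambda>_. bernoulli_pmf p)) {G. (\<Sum>e\<in>T. of_bool (G e)) \<le> p * real (card T) / 2}
    \<le> exp (- (p * real (card T)) / 10)"
proof -
  \<comment> \<open>From \<open>exp (- 1) \<le> 2 / 5\<close> the exponent is at most
    \<open>- 3 / 5 + 1 / 2 = - 1 / 10\<close> times the mean.\<close>
  have "5 / 2 \<le> exp (1 :: real)" using exp_lower_Taylor_quadratic[of "1::real"] by simp
  hence "exp (- 1) \<le> (2 / 5 :: real)" by (simp add: exp_minus field_simps)
  hence "p * real (card T) * (exp (- 1) - 1) \<le> p * real (card T) * (- 3 / 5)"
    using p by (intro mult_left_mono) auto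
  thus ?thesis
    using bernoulli_count_Chernoff[OF fin T p, of "- (p * real (card T) / 2)" "-1"] by (force intro: order_trans)
qed

section \<open>Cuts and degrees of the random graph\<close>

lemma finite_btl_pairs: "finite {(i, j). i < j \<and> j < (n::nat)}"
  by (rule finite_subset[of _ "{..<n} \<times> {..<n}"]) auto

lemma btl_degree_tail:
  assumes p: "0 \<le> p" "p \<le> 1" and i: "i < n"
  shows "measure_pmf.prob (btl_graph_pmf n p)
      {G. 4 * (real n * p) \<le> (\<Sum>j\<in>{..<n} - {i}. of_bool (G (min i j, max i j)))} \<le> exp (- 2 * (real n * p))"
proof -
  define e where "e j = (min i j, max i j)" for j
  define T where "T = e ` ({..<n} - {i})"
  have inj: "inj_on e ({..<n} - {i})"
    by (auto simp: inj_on_def e_def min_def max_def split: if_splits)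
  have "T \<subseteq> {(i, j). i < j \<and> j < n}"
    using i by (auto simp: T_def e_def min_def max_def)
  moreover have "p * real (card T) \<le> real n * p"
    using i p by (simp add: T_def card_image[OF inj] mult.commute mult_left_mono)
  moreover have "(\<Sum>j\<in>{..<n} - {i}. of_bool (G (min i j, max i j))) = (\<Sum>t\<in>T. of_bool (G t) :: real)" for G
    unfolding T_def by (subst sum.reindex[OF inj]) (simp add: e_def del: sum_of_bool_eq)
  ultimately show ?thesis
    unfolding btl_graph_pmf_def using bernoulli_count_upper_tail[OF finite_btl_pairs _ p] by simp
qed

text \<open>The pairs across the cut inject into unordered pairs, since the end lying in
  \<open>S\<close> can be recovered. The cut is therefore a count of independent edge
  indicators.\<close>

lemma btl_cut_tail:
  assumes p: "0 \<le> p" "p \<le> 1" and S: "S \<subseteq> {..<n}"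
  shows "measure_pmf.prob (btl_graph_pmf n p)
      {G. (\<Sum>i\<in>S. \<Sum>j\<in>{..<n} - S. of_bool (G (min i j, max i j))) \<le> p / 2 * (real (card S) * real (card ({..<n} - S)))}
    \<le> exp (- (p * (real (card S) * real (card ({..<n} - S)))) / 10)"
proof -
  define e where "e = (\<lambda>(i::nat, j). (min i j, max i j))"
  define T where "T = e ` (S \<times> ({..<n} - S))"
  have inj: "inj_on e (S \<times> ({..<n} - S))"
    by (auto simp: inj_on_def e_def min_def max_def split: if_splits)
  have "T \<subseteq> {(i, j). i < j \<and> j < n}"
  proof
    fix t assume "t \<in> T"
    then obtain i j where ij: "i \<in> S" "j < n" "j \<notin> S" "t = (min i j, max i j)"
      by (auto simp: T_def e_def)
    hence "i \<noteq> j" "i < n" using S by auto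
    with ij show "t \<in> {(i, j). i < j \<and> j < n}" by auto
  qed
  moreover have "real (card T) = real (card S) * real (card ({..<n} - S))"
    by (simp only: T_def card_image[OF inj] card_cartesian_product of_nat_mult)
  moreover have "(\<Sum>i\<in>S. \<Sum>j\<in>{..<n} - S. of_bool (G (min i j, max i j))) = (\<Sum>t\<in>T. of_bool (G t) :: real)" for G
    unfolding T_def sum.cartesian_product
    by (subst sum.reindex[OF inj]) (simp add: e_def case_prod_unfold del: sum_of_bool_eq)
  ultimately show ?thesis
    unfolding btl_graph_pmf_def using bernoulli_count_lower_tail[OF finite_btl_pairs _ p, of T n] by simp
qed

text \<open>By the binomial expansion all subsets together contribute \<open>(1 + Q) ^ n\<close>, at
  most \<open>exp (n * Q)\<close>; the empty set accounts for the 1. This evaluates the union bound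
  over cuts.\<close>

lemma sum_power_card_nonempty_subsets_le:
  fixes Q :: real
  assumes Q: "0 \<le> Q" "real n * Q \<le> 1"
  shows "(\<Sum>S\<in>Pow {..<n} - {{}}. Q ^ card S) \<le> 2 * (real n * Q)"
proof -
  have "(\<Sum>S\<in>Pow {..<n}. Q ^ card S) = (1 + Q) ^ n"
    using prod_add[of "{..<n}" "\<lambda>_. Q" "\<lambda>_. 1"] by (simp add: add.commute)
  also have "\<dots> \<le> exp Q ^ n"
    using Q by (intro power_mono exp_ge_add_one_self) auto
  also have "\<dots> = exp (real n * Q)" by (rule exp_of_nat_mult[symmetric])
  also have "\<dots> \<le> 1 + real n * Q + (real n * Q)\<^sup>2" using Q by (intro exp_bound) auto
  also have "(real n * Q)\<^sup>2 \<le> real n * Q"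
    using Q by (simp add: power2_eq_square mult_left_le)
  finally show ?thesis by (simp add: sum_diff1 mult.commute)
qed

text \<open>The union bound over exponentially many cuts is affordable because a cut whose smaller
  side has \<open>m\<close> items contains at least \<open>n * m / 2\<close> pairs. Its failure
  probability is at most \<open>Q ^ m\<close>, which beats the number of such sets.\<close>

lemma btl_all_cuts_tail:
  assumes p: "0 \<le> p" "p \<le> 1" and Q: "real n * exp (- (real n * p) / 20) \<le> 1"
  shows "measure_pmf.prob (btl_graph_pmf n p)
      {G. \<exists>S\<subseteq>{..<n}. (\<Sum>i\<in>S. \<Sum>j\<in>{..<n} - S. of_bool (G (min i j, max i j))) < p / 2 * (real (card S) * real (card ({..<n} - S)))}
    \<le> 4 * (real n * exp (- (real n * p) / 20))" (is "measure_pmf.prob ?M ?B \<le> _")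
proof -
  define Q where "Q = exp (- (real n * p) / 20)"
  define bad where "bad S = {G. (\<Sum>i\<in>S. \<Sum>j\<in>{..<n} - S. of_bool (G (min i j, max i j))) \<le> p / 2 * (real (card S) * real (card ({..<n} - S)))}" for S
  \<comment> \<open>The two trivial cuts are left out: they satisfy the non-strict inequality in
    \<open>bad\<close>, but never the strict one in the event to be bounded.\<close>
  define F where "F = Pow {..<n} - {{}, {..<n}}"
  have finF: "finite F" by (simp add: F_def)
  have single: "measure_pmf.prob ?M (bad S) \<le> Q ^ card S + Q ^ card ({..<n} - S)" if "S \<in> F" for S
  proof -
    have S: "S \<subseteq> {..<n}" using that by (auto simp: F_def)
    define s r where "s = real (card S)" and "r = real (card ({..<n} - S))"
    have sr: "s + r = real n" "s \<ge> 0" "r \<ge> 0"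
      using S card_mono[OF _ S] by (auto simp: s_def r_def card_Diff_subset finite_subset of_nat_diff)
    have "measure_pmf.prob ?M (bad S) \<le> exp (- (p * (s * r)) / 10)"
      unfolding bad_def s_def r_def by (rule btl_cut_tail[OF p S])
    also have "\<dots> \<le> exp (- (real n * p) / 20 * min s r)"
    proof -
      have "real n * min s r \<le> 2 * (s * r)"
      proof (cases "s \<le> r")
        case True
        hence "real n * s \<le> (2 * r) * s" using sr by (intro mult_right_mono) auto
        thus ?thesis using True by (simp add: mult_ac)
      next
        case False
        hence "real n * r \<le> (2 * s) * r" using sr by (intro mult_right_mono) auto
        thus ?thesis using False by (simp add: mult_ac)
      qed
      hence "p * (real n * min s r) \<le> p * (2 * (s * r))" using p by (intro mult_left_mono)
      thus ?thesis by (simp add: mult_ac)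
    qed
    \<comment> \<open>Bounding by the sum over both sides avoids a case distinction; complementation
      later identifies the two resulting sums.\<close>
    also have "\<dots> \<le> exp (- (real n * p) / 20 * s) + exp (- (real n * p) / 20 * r)"
      by (auto simp: min_def)
    also have "\<dots> = Q ^ card S + Q ^ card ({..<n} - S)"
      by (simp add: Q_def s_def r_def exp_of_nat_mult[symmetric] mult_ac)
    finally show ?thesis .
  qed
  have "?B \<subseteq> (\<Union>S\<in>F. bad S)"
  proof
    fix G assume "G \<in> ?B"
    then obtain S where S: "S \<subseteq> {..<n}" and lt: "(\<Sum>i\<in>S. \<Sum>j\<in>{..<n} - S. of_bool (G (min i j, max i j))) < p / 2 * (real (card S) * real (card ({..<n} - S)))"
      by blast
    hence "S \<noteq> {}" "S \<noteq> {..<n}" by auto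
    with S lt show "G \<in> (\<Union>S\<in>F. bad S)" by (auto simp: F_def bad_def intro!: bexI[of _ S])
  qed
  hence "measure_pmf.prob ?M ?B \<le> measure_pmf.prob ?M (\<Union>S\<in>F. bad S)"
    by (intro measure_pmf.finite_measure_mono) auto
  also have "\<dots> \<le> (\<Sum>S\<in>F. measure_pmf.prob ?M (bad S))"
    by (intro measure_pmf.finite_measure_subadditive_finite finF) auto
  also have "\<dots> \<le> (\<Sum>S\<in>F. Q ^ card S) + (\<Sum>S\<in>F. Q ^ card ({..<n} - S))"
    unfolding sum.distrib[symmetric] by (intro sum_mono single)
  also have "(\<Sum>S\<in>F. Q ^ card S) \<le> (\<Sum>S\<in>Pow {..<n} - {{}}. Q ^ card S)"
    by (intro sum_mono2) (auto simp: F_def Q_def)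
  also have "(\<Sum>S\<in>F. Q ^ card ({..<n} - S)) = (\<Sum>S\<in>F. Q ^ card S)"
    by (rule sum.reindex_bij_witness[of _ "\<lambda>S. {..<n} - S" "\<lambda>S. {..<n} - S"]) (auto simp: F_def)
  also have "(\<Sum>S\<in>F. Q ^ card S) \<le> (\<Sum>S\<in>Pow {..<n} - {{}}. Q ^ card S)"
    by (intro sum_mono2) (auto simp: F_def Q_def)
  also have "(\<Sum>S\<in>Pow {..<n} - {{}}. Q ^ card S) \<le> 2 * (real n * Q)"
    using assms by (intro sum_power_card_nonempty_subsets_le) (auto simp: Q_def)
  finally show ?thesis by (simp add: Q_def)
qed

section \<open>Conditioning on the graph and simultaneous noise bounds\<close>

text \<open>Fubini for a two-stage experiment: the graph is drawn first, and for each graph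
  satisfying \<open>P\<close> the comparisons fail with probability at most \<open>\<beta>\<close>.
  On the other graphs the inner probability is bounded by 1.\<close>

lemma prob_pair_pmf_ge:
  assumes P: "measure_pmf.prob M {x. \<not> P x} \<le> \<alpha>"
    and Q: "\<And>x. P x \<Longrightarrow> measure_pmf.prob N {y. \<not> Q (x, y)} \<le> \<beta>" and \<beta>: "\<beta> \<ge> 0"
  shows "measure_pmf.prob (pair_pmf M N) {z. Q z} \<ge> 1 - (\<alpha> + \<beta>)"
proof -
  have "ennreal (measure_pmf.prob (pair_pmf M N) {z. \<not> Q z}) = (\<integral>\<^sup>+z. indicator {z. \<not> Q z} z \<partial>pair_pmf M N)"
    by (simp add: measure_pmf.emeasure_eq_measure)
  also have "\<dots> = (\<integral>\<^sup>+x. \<integral>\<^sup>+y. indicator {z. \<not> Q z} (x, y) \<partial>N \<partial>M)"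
    by (rule nn_integral_pair_pmf')
  also have "\<dots> = (\<integral>\<^sup>+x. ennreal (measure_pmf.prob N {y. \<not> Q (x, y)}) \<partial>M)"
  proof (intro nn_integral_cong)
    fix x
    have "(\<integral>\<^sup>+y. indicator {z. \<not> Q z} (x, y) \<partial>N) = (\<integral>\<^sup>+y. indicator {y. \<not> Q (x, y)} y \<partial>N)"
      by (intro nn_integral_cong) (simp add: indicator_def)
    thus "(\<integral>\<^sup>+y. indicator {z. \<not> Q z} (x, y) \<partial>N) = ennreal (measure_pmf.prob N {y. \<not> Q (x, y)})"
      by (simp add: measure_pmf.emeasure_eq_measure)
  qed
  also have "\<dots> \<le> (\<integral>\<^sup>+x. indicator {x. \<not> P x} x + ennreal \<beta> \<partial>M)"
  proof (intro nn_integral_mono)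
    fix x
    show "ennreal (measure_pmf.prob N {y. \<not> Q (x, y)}) \<le> indicator {x. \<not> P x} x + ennreal \<beta>"
    proof (cases "P x")
      case False
      have "ennreal (measure_pmf.prob N {y. \<not> Q (x, y)}) \<le> ennreal 1" by (rule ennreal_leI) simp
      also have "\<dots> \<le> 1 + ennreal \<beta>" by simp
      finally show ?thesis using False by simp
    qed (use Q in \<open>auto intro!: ennreal_leI\<close>)
  qed
  also have "\<dots> = ennreal (measure_pmf.prob M {x. \<not> P x} + \<beta>)"
    using \<beta> by (subst nn_integral_add) (auto simp: measure_pmf.emeasure_eq_measure)
  finally have "measure_pmf.prob (pair_pmf M N) {z. \<not> Q z} \<le> measure_pmf.prob M {x. \<not> P x} + \<beta>"
    using \<beta> by (subst (asm) ennreal_le_iff) auto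
  moreover have "{z. \<not> Q z} = UNIV - {z. Q z}" by auto
  ultimately show ?thesis
    using P measure_pmf.prob_compl[of "{z. Q z}" "pair_pmf M N"] by simp
qed

lemma exp_minus_mult_ln:
  assumes "0 < n"
  shows "exp (- (real k * ln (real n))) = 1 / real n ^ k"
  using assms by (simp add: exp_minus exp_of_nat_mult field_simps)

lemma bernoulli_block_noise:
  fixes c q :: "'a \<Rightarrow> real" and K :: "nat \<Rightarrow> 'a set"
  assumes n: "0 < n" and fin: "finite I" and K: "\<And>i. i < n \<Longrightarrow> K i \<subseteq> I" and disj: "disjoint_family_on K {..<n}"
    and q: "\<And>t. t \<in> I \<Longrightarrow> 0 \<le> q t \<and> q t \<le> 1"
    and V: "\<And>i. i < n \<Longrightarrow> (\<Sum>t\<in>K i. (c t)\<^sup>2) \<le> V" "V > 0"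
  shows "measure_pmf.prob (Pi_pmf I False (\<lambda>t. bernoulli_pmf (q t)))
      {Y. (\<exists>i<n. 3 * V * ln (real n) \<le> (\<Sum>t\<in>K i. c t * (of_bool (Y t) - q t))\<^sup>2) \<or>
          8 * real n * V \<le> (\<Sum>i<n. (\<Sum>t\<in>K i. c t * (of_bool (Y t) - q t))\<^sup>2)} \<le> 3 / real n ^ 5"
    (is "measure_pmf.prob ?M ?S \<le> _")
proof -
  \<comment> \<open>Hoeffding is used with \<open>s = 6 * ln n\<close>: one power of
    \<open>n\<close> is spent on the union bound over items, leaving
    \<open>2 / n ^ 5\<close>.\<close>
  define A where "A i = {Y. (6 * ln (real n)) * V / 2 \<le> (\<Sum>t\<in>K i. c t * (of_bool (Y t) - q t))\<^sup>2}" for i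
  define B where "B = {Y. 8 * real n * V \<le> (\<Sum>i<n. (\<Sum>t\<in>K i. c t * (of_bool (Y t) - q t))\<^sup>2)}"
  have "?S = (\<Union>i<n. A i) \<union> B" by (auto simp: A_def B_def mult_ac)
  hence "measure_pmf.prob ?M ?S \<le> measure_pmf.prob ?M (\<Union>i<n. A i) + measure_pmf.prob ?M B"
    by (simp add: measure_Un_le)
  also have "measure_pmf.prob ?M (\<Union>i<n. A i) \<le> (\<Sum>i<n. measure_pmf.prob ?M (A i))"
    by (intro measure_pmf.finite_measure_subadditive_finite) auto
  also have "\<dots> \<le> (\<Sum>i<n. 2 * exp (- (6 * ln (real n))))"
    unfolding A_def using n by (intro sum_mono bernoulli_sum_Hoeffding fin K q V) auto
  also have "\<dots> = 2 / real n ^ 5"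
    using exp_minus_mult_ln[OF n, of 6] n by (simp add: eval_nat_numeral)
  also have "measure_pmf.prob ?M B \<le> exp (- 5 * real n)"
    using bernoulli_block_sums_square_tail[of I "{..<n}" K q c V] fin K disj q V by (simp add: B_def)
  also have "exp (- 5 * real n) \<le> 1 / real n ^ 5"
  proof -
    have "exp (- 5 * real n) \<le> exp (- (real 5 * ln (real n)))"
      using ln_le_minus_one[of "real n"] n by simp
    thus ?thesis unfolding exp_minus_mult_ln[OF n] .
  qed
  finally show ?thesis by (simp add: add_divide_distrib[symmetric])
qed

section \<open>The Bradley--Terry--Luce chain\<close>

lemma btl_y_bounds:
  assumes "L \<ge> 1"
  shows "0 \<le> btl_y L \<omega> i j" and "i \<noteq> j \<Longrightarrow> btl_y L \<omega> i j + btl_y L \<omega> j i = 1"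
proof -
  have *: "(\<Sum>l<L. of_bool (P l) :: real) / real L \<le> 1" for P
  proof -
    have "(\<Sum>l<L. of_bool (P l) :: real) \<le> (\<Sum>l<L. 1)" by (intro sum_mono) auto
    thus ?thesis using assms by (simp del: sum_of_bool_eq)
  qed
  show "0 \<le> btl_y L \<omega> i j"
    using *[of "\<lambda>l. snd \<omega> (j, i, l)"] by (simp add: btl_y_def sum_nonneg del: sum_of_bool_eq)
  show "btl_y L \<omega> i j + btl_y L \<omega> j i = 1" if "i \<noteq> j"
    using that by (auto simp: btl_y_def)
qed

text \<open>The diagonal of the transition matrix retains the mass that does not move, so
  stationarity at \<open>j\<close> equates inflow and outflow; both carry the same factor
  \<open>1 / d\<close>.\<close>

lemma stationary_btl_P_balance:
  assumes d: "d > 0" and st: "stationary n (btl_P n L d \<omega>) \<pi>" and j: "j < n"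
  shows "(\<Sum>i<n. \<pi> i * (of_bool (btl_edge \<omega> i j) * btl_y L \<omega> i j))
       = \<pi> j * (\<Sum>k<n. of_bool (btl_edge \<omega> j k) * btl_y L \<omega> j k)"
proof -
  define a where "a i j = of_bool (btl_edge \<omega> i j) * btl_y L \<omega> i j" for i j
  have ajj: "a j j = 0" by (simp add: a_def btl_edge_def)
  have row: "(\<Sum>k\<in>{k. k < n \<and> btl_edge \<omega> i k}. btl_y L \<omega> i k) = (\<Sum>k<n. a i k)" for i
    by (rule sum.mono_neutral_cong_left) (auto simp: a_def)
  have P: "btl_P n L d \<omega> i j = (if i = j then 1 - (\<Sum>k<n. a j k) / d else 0) + a i j / d" for i
    using ajj by (auto simp: btl_P_def row a_def)
  have "\<pi> j = (\<Sum>i<n. \<pi> i * btl_P n L d \<omega> i j)"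
    using st j by (simp add: stationary_def)
  also have "\<dots> = (\<Sum>i<n. (if i = j then \<pi> i * (1 - (\<Sum>k<n. a j k) / d) else 0) + \<pi> i * a i j / d)"
    by (intro sum.cong refl) (simp add: P distrib_left)
  also have "\<dots> = \<pi> j * (1 - (\<Sum>k<n. a j k) / d) + (\<Sum>i<n. \<pi> i * a i j) / d"
    using j by (simp add: sum.distrib sum_divide_distrib)
  finally show ?thesis
    using d by (simp add: a_def field_simps)
qed

section \<open>Imbalances as weighted sums of centred comparisons\<close>

text \<open>Coefficient of one comparison in the imbalance. On an edge,
  \<open>\<pi>\<^sup>* i * y i j - \<pi>\<^sup>* j * y j i\<close> equals
  \<open>\<pi>\<^sup>* i + \<pi>\<^sup>* j\<close> times the deviation of \<open>y i j\<close> from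
  its mean, and \<open>y i j\<close> averages \<open>L\<close> outcomes.\<close>

definition btl_weight :: "nat \<Rightarrow> nat \<Rightarrow> (nat \<Rightarrow> real) \<Rightarrow> (nat \<times> nat \<Rightarrow> bool) \<Rightarrow> nat \<times> nat \<times> nat \<Rightarrow> real" where
  "btl_weight n L w G = (\<lambda>(i, j, l). of_bool (G (i, j)) * (pi_star n w i + pi_star n w j) / real L)"

definition btl_noise :: "nat \<Rightarrow> nat \<Rightarrow> (nat \<Rightarrow> real) \<Rightarrow> btl_sample \<Rightarrow> (nat \<times> nat \<times> nat) set \<Rightarrow> real" where
  "btl_noise n L w \<omega> K = (\<Sum>t\<in>K. btl_weight n L w (fst \<omega>) t *
     (of_bool (snd \<omega> t) - (case t of (i, j, l) \<Rightarrow> w j / (w i + w j))))"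

text \<open>The imbalance of item \<open>i\<close> is split into its comparisons with later and with earlier items.
  Each pair lies in exactly one upper and one lower row, so that the contributions of the upper
  (respectively lower) rows of different items are independent, although the full imbalances are not.\<close>

definition upper_row :: "nat \<Rightarrow> nat \<Rightarrow> nat \<Rightarrow> (nat \<times> nat \<times> nat) set" where
  "upper_row n L i = {i} \<times> {i<..<n} \<times> {..<L}"

definition lower_row :: "nat \<Rightarrow> nat \<Rightarrow> (nat \<times> nat \<times> nat) set" where
  "lower_row L i = {..<i} \<times> {i} \<times> {..<L}"

text \<open>Detailed balance of \<open>\<pi>\<^sup>*\<close> centres every edge term. Outcomes are
  stored with the smaller index first, so comparisons with earlier items enter from the opposite
  side and change sign.\<close>

lemma btl_imbalance_eq_noise:
  assumes L: "L \<ge> 1" and w: "\<And>i. i < n \<Longrightarrow> w i > 0" and j: "j < n"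
  shows "(\<Sum>k<n. of_bool (btl_edge \<omega> j k) * (pi_star n w j * btl_y L \<omega> j k - pi_star n w k * btl_y L \<omega> k j))
     = btl_noise n L w \<omega> (upper_row n L j) - btl_noise n L w \<omega> (lower_row L j)"
proof -
  define W where "W = (\<Sum>k<n. w k)"
  have W: "W > 0" unfolding W_def using w j by (intro sum_pos) auto
  define \<mu> where "\<mu> = pi_star n w"
  have \<mu>: "\<mu> i = w i / W" for i by (simp add: \<mu>_def pi_star_def W_def)
  \<comment> \<open>Detailed balance: the mean of \<open>y i k\<close>, scaled by the edge weight,
    is exactly \<open>\<mu> k\<close>.\<close>
  have frac: "(\<mu> i + \<mu> k) * (w k / (w i + w k)) = \<mu> k" if "i < n" "k < n" for i k
  proof -
    have "w i + w k > 0" using w[OF that(1)] w[OF that(2)] by simp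
    thus ?thesis using W by (simp add: \<mu> add_divide_distrib[symmetric])
  qed
  define T where "T k = of_bool (btl_edge \<omega> j k) * (\<mu> j * btl_y L \<omega> j k - \<mu> k * btl_y L \<omega> k j)" for k
  have row: "(\<Sum>l<L. btl_weight n L w (fst \<omega>) (i, k, l) * (of_bool (snd \<omega> (i, k, l)) - w k / (w i + w k)))
      = of_bool (fst \<omega> (i, k)) * ((\<mu> i + \<mu> k) * btl_y L \<omega> i k - \<mu> k)" if "i < k" "k < n" for i k
  proof -
    have "(\<Sum>l<L. btl_weight n L w (fst \<omega>) (i, k, l) * (of_bool (snd \<omega> (i, k, l)) - w k / (w i + w k)))
      = of_bool (fst \<omega> (i, k)) * (\<mu> i + \<mu> k) / real L * (\<Sum>l<L. of_bool (snd \<omega> (i, k, l)) - w k / (w i + w k))"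
      by (simp only: btl_weight_def prod.case sum_distrib_left \<mu>_def)
    also have "(\<Sum>l<L. of_bool (snd \<omega> (i, k, l)) - w k / (w i + w k)) = real L * (btl_y L \<omega> i k - w k / (w i + w k))"
      using L that by (simp add: btl_y_def sum_subtractf field_simps del: sum_of_bool_eq)
    also have "of_bool (fst \<omega> (i, k)) * (\<mu> i + \<mu> k) / real L * (real L * (btl_y L \<omega> i k - w k / (w i + w k)))
       = of_bool (fst \<omega> (i, k)) * ((\<mu> i + \<mu> k) * btl_y L \<omega> i k - (\<mu> i + \<mu> k) * (w k / (w i + w k)))"
      using L by (simp add: right_diff_distrib)
    finally show ?thesis using frac[of i k] that by simp
  qed
  have up: "btl_noise n L w \<omega> (upper_row n L j) = (\<Sum>k\<in>{j<..<n}. T k)"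
  proof -
    have "btl_noise n L w \<omega> (upper_row n L j) = (\<Sum>k\<in>{j<..<n}. \<Sum>l<L. btl_weight n L w (fst \<omega>) (j, k, l) * (of_bool (snd \<omega> (j, k, l)) - w k / (w j + w k)))"
      by (simp add: btl_noise_def upper_row_def sum.cartesian_product' case_prod_unfold)
    also have "\<dots> = (\<Sum>k\<in>{j<..<n}. T k)"
    proof (intro sum.cong refl)
      fix k assume k: "k \<in> {j<..<n}"
      hence y: "btl_y L \<omega> k j = 1 - btl_y L \<omega> j k" using btl_y_bounds(2)[OF L, of j k \<omega>] by simp
      have "(\<mu> j + \<mu> k) * btl_y L \<omega> j k - \<mu> k = \<mu> j * btl_y L \<omega> j k - \<mu> k * btl_y L \<omega> k j"
        by (simp only: y) (simp add: algebra_simps)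
      thus "(\<Sum>l<L. btl_weight n L w (fst \<omega>) (j, k, l) * (of_bool (snd \<omega> (j, k, l)) - w k / (w j + w k))) = T k"
        using k by (subst row) (auto simp: T_def btl_edge_def)
    qed
    finally show ?thesis .
  qed
  have lo: "btl_noise n L w \<omega> (lower_row L j) = - (\<Sum>k<j. T k)"
  proof -
    have "btl_noise n L w \<omega> (lower_row L j) = (\<Sum>k<j. \<Sum>l<L. btl_weight n L w (fst \<omega>) (k, j, l) * (of_bool (snd \<omega> (k, j, l)) - w j / (w k + w j)))"
      by (simp add: btl_noise_def lower_row_def sum.cartesian_product' case_prod_unfold)
    also have "\<dots> = (\<Sum>k<j. - T k)"
    proof (intro sum.cong refl)
      fix k assume k: "k \<in> {..<j}"
      hence y: "btl_y L \<omega> j k = 1 - btl_y L \<omega> k j" using btl_y_bounds(2)[OF L, of j k \<omega>] by simp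
      have "(\<mu> k + \<mu> j) * btl_y L \<omega> k j - \<mu> j = - (\<mu> j * btl_y L \<omega> j k - \<mu> k * btl_y L \<omega> k j)"
        by (simp only: y) (simp add: algebra_simps)
      thus "(\<Sum>l<L. btl_weight n L w (fst \<omega>) (k, j, l) * (of_bool (snd \<omega> (k, j, l)) - w j / (w k + w j))) = - T k"
        using k j by (subst row) (auto simp: T_def btl_edge_def)
    qed
    finally show ?thesis by (simp add: sum_negf)
  qed
  have "{..<n} = insert j ({..<j} \<union> {j<..<n})" using j by auto
  hence "(\<Sum>k<n. T k) = T j + (sum T ({..<j} \<union> {j<..<n}))" by simp
  also have "T j = 0" by (simp add: T_def btl_edge_def)
  also have "sum T ({..<j} \<union> {j<..<n}) = (\<Sum>k<j. T k) + (\<Sum>k\<in>{j<..<n}. T k)"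
    by (rule sum.union_disjoint) auto
  finally show ?thesis using up lo by (simp add: T_def \<mu>_def)
qed

lemma pi_star_bounds:
  assumes \<kappa>: "\<kappa> > 0" and w: "\<And>i. i < n \<Longrightarrow> w i > 0"
    and w\<kappa>: "\<And>i j. i < n \<Longrightarrow> j < n \<Longrightarrow> w i \<le> \<kappa> * w j" and i: "i < n"
  shows "1 / (\<kappa> * real n) \<le> pi_star n w i" and "pi_star n w i \<le> \<kappa> / real n"
    and "(\<Sum>i<n. pi_star n w i) = 1"
proof -
  define W where "W = (\<Sum>k<n. w k)"
  have W: "W > 0" unfolding W_def using w i by (intro sum_pos) auto
  have "W \<le> (\<Sum>k<n. \<kappa> * w i)" unfolding W_def by (intro sum_mono w\<kappa> i) simp
  hence "W \<le> \<kappa> * real n * w i" by (simp add: mult_ac)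
  thus "1 / (\<kappa> * real n) \<le> pi_star n w i"
    using W \<kappa> i by (simp add: pi_star_def W_def[symmetric] field_simps)
  have "(\<Sum>k<n. w i) \<le> (\<Sum>k<n. \<kappa> * w k)" by (intro sum_mono w\<kappa> i) simp
  hence "real n * w i \<le> \<kappa> * W" by (simp add: W_def sum_distrib_left)
  thus "pi_star n w i \<le> \<kappa> / real n"
    using W i by (simp add: pi_star_def W_def[symmetric] field_simps)
  show "(\<Sum>i<n. pi_star n w i) = 1"
    using W by (simp add: pi_star_def sum_divide_distrib[symmetric] W_def)
qed

text \<open>Variance proxy of a row: at most \<open>4 * n * p\<close> edges with \<open>L\<close>
  comparisons each, every squared weight being at most
  \<open>(2 * \<kappa> / (n * L))\<^sup>2\<close>. The full degree bound is used for the upper and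
  for the lower row alike.\<close>

lemma btl_weight_rows:
  assumes \<kappa>: "\<kappa> > 0" and L: "L \<ge> 1" and w: "\<And>i. i < n \<Longrightarrow> w i > 0"
    and w\<kappa>: "\<And>i j. i < n \<Longrightarrow> j < n \<Longrightarrow> w i \<le> \<kappa> * w j" and i: "i < n"
    and deg: "(\<Sum>j\<in>{..<n} - {i}. of_bool (G (min i j, max i j))) \<le> 4 * (real n * p)"
  shows "(\<Sum>t\<in>upper_row n L i. (btl_weight n L w G t)\<^sup>2) \<le> 16 * \<kappa>\<^sup>2 * p / (real n * real L)"
    and "(\<Sum>t\<in>lower_row L i. (btl_weight n L w G t)\<^sup>2) \<le> 16 * \<kappa>\<^sup>2 * p / (real n * real L)"
proof -
  have n: "0 < n" using i by simp
  have \<mu>: "0 \<le> pi_star n w k" "pi_star n w k \<le> \<kappa> / real n" if "k < n" for k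
  proof -
    have "0 < 1 / (\<kappa> * real n)" using \<kappa> n by simp
    with pi_star_bounds(1)[where w = w, OF \<kappa> w w\<kappa> that] show "0 \<le> pi_star n w k" by linarith
    show "pi_star n w k \<le> \<kappa> / real n" by (rule pi_star_bounds(2)[where w = w, OF \<kappa> w w\<kappa> that])
  qed
  have wt: "(btl_weight n L w G (a, b, l))\<^sup>2 \<le> of_bool (G (a, b)) * (2 * \<kappa> / (real n * real L))\<^sup>2"
    if "a < n" "b < n" for a b l
  proof -
    have "((pi_star n w a + pi_star n w b) / real L)\<^sup>2 \<le> (2 * \<kappa> / (real n * real L))\<^sup>2"
    proof (rule power_mono)
      have "(pi_star n w a + pi_star n w b) / real L \<le> (\<kappa> / real n + \<kappa> / real n) / real L"
        using \<mu> that by (intro divide_right_mono add_mono) auto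
      thus "(pi_star n w a + pi_star n w b) / real L \<le> 2 * \<kappa> / (real n * real L)" by simp
    qed (use \<mu> that in simp)
    thus ?thesis by (simp add: btl_weight_def)
  qed
  define s where "s j = (of_bool (G (min i j, max i j)) :: real)" for j
  have tot: "(\<Sum>j\<in>J. real L * (s j * (2 * \<kappa> / (real n * real L))\<^sup>2)) \<le> 16 * \<kappa>\<^sup>2 * p / (real n * real L)"
    if "J \<subseteq> {..<n} - {i}" for J
  proof -
    have "(\<Sum>j\<in>J. s j) \<le> (\<Sum>j\<in>{..<n} - {i}. s j)"
      using that by (intro sum_mono2) (auto simp: s_def)
    hence J: "(\<Sum>j\<in>J. s j) \<le> 4 * (real n * p)" using deg unfolding s_def by linarith
    have "(\<Sum>j\<in>J. real L * (s j * (2 * \<kappa> / (real n * real L))\<^sup>2)) = 4 * \<kappa>\<^sup>2 / ((real n)\<^sup>2 * real L) * (\<Sum>j\<in>J. s j)"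
    proof -
      have "real L * (x * (2 * \<kappa> / (real n * real L))\<^sup>2) = 4 * \<kappa>\<^sup>2 / ((real n)\<^sup>2 * real L) * x" for x
        using L by (simp add: power2_eq_square mult_ac)
      thus ?thesis by (simp only: sum_distrib_left)
    qed
    also have "\<dots> \<le> 4 * \<kappa>\<^sup>2 / ((real n)\<^sup>2 * real L) * (4 * (real n * p))"
      by (intro mult_left_mono J) auto
    also have "4 * \<kappa>\<^sup>2 / ((real n)\<^sup>2 * real L) * (4 * (real n * p)) = 16 * \<kappa>\<^sup>2 * p / (real n * real L)"
      using L n by (simp add: power2_eq_square field_simps)
    finally show ?thesis .
  qed
  have "(\<Sum>t\<in>upper_row n L i. (btl_weight n L w G t)\<^sup>2) = (\<Sum>j\<in>{i<..<n}. \<Sum>l<L. (btl_weight n L w G (i, j, l))\<^sup>2)"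
    by (simp add: upper_row_def sum.cartesian_product')
  also have "\<dots> \<le> (\<Sum>j\<in>{i<..<n}. \<Sum>l<L. of_bool (G (i, j)) * (2 * \<kappa> / (real n * real L))\<^sup>2)"
    by (intro sum_mono wt i) auto
  also have "\<dots> = (\<Sum>j\<in>{i<..<n}. real L * (s j * (2 * \<kappa> / (real n * real L))\<^sup>2))"
    by (intro sum.cong refl) (simp add: s_def)
  also have "\<dots> \<le> 16 * \<kappa>\<^sup>2 * p / (real n * real L)" by (rule tot) auto
  finally show "(\<Sum>t\<in>upper_row n L i. (btl_weight n L w G t)\<^sup>2) \<le> 16 * \<kappa>\<^sup>2 * p / (real n * real L)" .
  have "(\<Sum>t\<in>lower_row L i. (btl_weight n L w G t)\<^sup>2) = (\<Sum>j<i. \<Sum>l<L. (btl_weight n L w G (j, i, l))\<^sup>2)"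
    by (simp add: lower_row_def sum.cartesian_product')
  also have "\<dots> \<le> (\<Sum>j<i. \<Sum>l<L. of_bool (G (j, i)) * (2 * \<kappa> / (real n * real L))\<^sup>2)"
    using i by (intro sum_mono wt) auto
  also have "\<dots> = (\<Sum>j<i. real L * (s j * (2 * \<kappa> / (real n * real L))\<^sup>2))"
    by (intro sum.cong refl) (simp add: s_def)
  also have "\<dots> \<le> 16 * \<kappa>\<^sup>2 * p / (real n * real L)" using i by (intro tot) auto
  finally show "(\<Sum>t\<in>lower_row L i. (btl_weight n L w G t)\<^sup>2) \<le> 16 * \<kappa>\<^sup>2 * p / (real n * real L)" .
qed

text \<open>With the graph frozen the weights are deterministic, and the general block bound applies
  to the comparisons alone.\<close>

lemma btl_noise_tail:
  fixes K :: "nat \<Rightarrow> (nat \<times> nat \<times> nat) set"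
  assumes n: "0 < n" and w: "\<And>i. i < n \<Longrightarrow> w i > 0"
    and K: "\<And>i. i < n \<Longrightarrow> K i \<subseteq> {(i, j, l). i < j \<and> j < n \<and> l < L}" and disj: "disjoint_family_on K {..<n}"
    and V: "\<And>i. i < n \<Longrightarrow> (\<Sum>t\<in>K i. (btl_weight n L w G t)\<^sup>2) \<le> V" "V > 0"
  shows "measure_pmf.prob (btl_comp_pmf n L w)
      {Y. (\<exists>i<n. 3 * V * ln (real n) \<le> (btl_noise n L w (G, Y) (K i))\<^sup>2) \<or>
          8 * real n * V \<le> (\<Sum>i<n. (btl_noise n L w (G, Y) (K i))\<^sup>2)} \<le> 3 / real n ^ 5"
proof -
  let ?I = "{(i, j, l). i < j \<and> j < n \<and> l < L}"
  have fin: "finite ?I"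
    by (rule finite_subset[of _ "{..<n} \<times> {..<n} \<times> {..<L}"]) auto
  have q: "0 \<le> (case t of (i, j, l) \<Rightarrow> w j / (w i + w j)) \<and> (case t of (i, j, l) \<Rightarrow> w j / (w i + w j)) \<le> 1"
    if "t \<in> ?I" for t
  proof -
    obtain i j l where t: "t = (i, j, l)" "i < j" "j < n" using \<open>t \<in> ?I\<close> by auto
    hence "w i > 0" "w j > 0" using w by auto
    thus ?thesis by (simp add: t)
  qed
  have M: "btl_comp_pmf n L w = Pi_pmf ?I False (\<lambda>t. bernoulli_pmf (case t of (i, j, l) \<Rightarrow> w j / (w i + w j)))"
    by (simp add: btl_comp_pmf_def case_prod_unfold)
  show ?thesis
    unfolding M btl_noise_def fst_conv snd_conv
    by (rule bernoulli_block_noise[OF n fin K disj q V])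
qed

section \<open>Error bound on the good event, and the probability of that event\<close>

text \<open>Purely deterministic: regularity of the graph and the noise bounds are fed into the
  comparison of error with imbalance. The pointwise noise bounds give smallness of the imbalances,
  the summed ones give the rate.\<close>

lemma btl_error_bound:
  fixes \<kappa> p d :: real
  assumes n: "0 < n" and L: "L \<ge> 1" and \<kappa>: "\<kappa> \<ge> 1" and p: "p > 0" and d: "d > 0"
    and w: "\<And>i. i < n \<Longrightarrow> w i > 0"
    and w\<kappa>: "\<And>i j. i < n \<Longrightarrow> j < n \<Longrightarrow> w i \<le> \<kappa> * w j"
    and c0: "192 * 65536 * \<kappa> ^ 8 * ln (real n) \<le> real n * p"
    and deg: "\<And>i. i < n \<Longrightarrow> (\<Sum>j\<in>{..<n} - {i}. of_bool (fst \<omega> (min i j, max i j))) \<le> 4 * (real n * p)"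
    and cut: "\<And>S. S \<subseteq> {..<n} \<Longrightarrow> p / 2 * (real (card S) * real (card ({..<n} - S)))
        \<le> (\<Sum>i\<in>S. \<Sum>j\<in>{..<n} - S. of_bool (fst \<omega> (min i j, max i j)))"
  defines "V \<equiv> 16 * \<kappa>\<^sup>2 * p / (real n * real L)"
  assumes up: "\<And>i. i < n \<Longrightarrow> (btl_noise n L w \<omega> (upper_row n L i))\<^sup>2 \<le> 3 * V * ln (real n)"
      "(\<Sum>i<n. (btl_noise n L w \<omega> (upper_row n L i))\<^sup>2) \<le> 8 * real n * V"
    and lo: "\<And>i. i < n \<Longrightarrow> (btl_noise n L w \<omega> (lower_row L i))\<^sup>2 \<le> 3 * V * ln (real n)"
      "(\<Sum>i<n. (btl_noise n L w \<omega> (lower_row L i))\<^sup>2) \<le> 8 * real n * V"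
    and st: "stationary n (btl_P n L d \<omega>) \<pi>"
  shows "l2norm n (\<lambda>i. \<pi> i - pi_star n w i) / l2norm n (pi_star n w)
    \<le> 12000 * \<kappa> ^ 5 / sqrt (real n * p * real L)"
proof -
  define b where "b j = btl_noise n L w \<omega> (upper_row n L j) - btl_noise n L w \<omega> (lower_row L j)" for j
  define \<mu> where "\<mu> = pi_star n w"
  define A where "A i j = (of_bool (btl_edge \<omega> i j) :: real)" for i j
  have \<kappa>0: "\<kappa> > 0" using \<kappa> by simp
  have \<mu>b: "1 / (\<kappa> * real n) \<le> \<mu> i" "\<mu> i \<le> \<kappa> / real n" if "i < n" for i
    unfolding \<mu>_def using pi_star_bounds(1,2)[OF \<kappa>0, of n w i] w w\<kappa> that by blast+
  have \<mu>1: "(\<Sum>i<n. \<mu> i) = 1"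
    unfolding \<mu>_def using pi_star_bounds(3)[OF \<kappa>0, of n w 0] w w\<kappa> n by blast
  have small: "\<bar>b j\<bar> \<le> p / (256 * \<kappa> ^ 3)" if "j < n" for j
  proof -
    \<comment> \<open>Each row may use half of the allowance
      \<open>p / (256 * \<kappa> ^ 3)\<close>. As
      \<open>48 / (192 * 65536) = 1 / 512\<^sup>2\<close>, this is where the constant in the
      assumption on \<open>p\<close> comes from.\<close>
    have "3 * V * ln (real n) \<le> (p / (512 * \<kappa> ^ 3))\<^sup>2"
    proof -
      have "ln (real n) \<ge> 0" using n by simp
      hence "3 * V * ln (real n) = 48 * \<kappa>\<^sup>2 * p * (ln (real n) / real n) / real L"
        by (simp add: V_def)
      also have "\<dots> \<le> 48 * \<kappa>\<^sup>2 * p * (ln (real n) / real n) / 1"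
        using L p n by (intro divide_left_mono) auto
      also have "ln (real n) / real n \<le> p / (192 * 65536 * \<kappa> ^ 8)"
        using c0 n \<kappa>0 by (simp add: field_simps)
      also have "48 * \<kappa>\<^sup>2 * p * (p / (192 * 65536 * \<kappa> ^ 8)) / 1 = (p / (512 * \<kappa> ^ 3))\<^sup>2"
      proof -
        have "\<kappa> ^ 8 = \<kappa> * \<kappa> * (\<kappa> ^ 3 * \<kappa> ^ 3)" by (simp add: eval_nat_numeral)
        thus ?thesis unfolding power2_eq_square using \<kappa>0 by simp
      qed
      finally show ?thesis using p by (simp add: mult_left_mono)
    qed
    hence "(btl_noise n L w \<omega> (upper_row n L j))\<^sup>2 \<le> (p / (512 * \<kappa> ^ 3))\<^sup>2"
      and "(btl_noise n L w \<omega> (lower_row L j))\<^sup>2 \<le> (p / (512 * \<kappa> ^ 3))\<^sup>2"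
      using up(1)[OF that] lo(1)[OF that] by linarith+
    hence "\<bar>btl_noise n L w \<omega> (upper_row n L j)\<bar> \<le> p / (512 * \<kappa> ^ 3)"
      and "\<bar>btl_noise n L w \<omega> (lower_row L j)\<bar> \<le> p / (512 * \<kappa> ^ 3)"
      using p \<kappa>0 by (auto simp: power2_le_iff_abs_le)
    hence "\<bar>b j\<bar> \<le> p / (512 * \<kappa> ^ 3) + p / (512 * \<kappa> ^ 3)" unfolding b_def by linarith
    thus ?thesis by simp
  qed
  have B: "(\<Sum>j<n. (b j)\<^sup>2) \<le> 512 * \<kappa>\<^sup>2 * p / real L"
  proof -
    have "(\<Sum>j<n. (b j)\<^sup>2) \<le> (\<Sum>j<n. 2 * (btl_noise n L w \<omega> (upper_row n L j))\<^sup>2 + 2 * (btl_noise n L w \<omega> (lower_row L j))\<^sup>2)"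
    proof (rule sum_mono)
      fix j
      have "(x - y)\<^sup>2 \<le> 2 * x\<^sup>2 + 2 * y\<^sup>2" for x y :: real
        using zero_le_power2[of "x + y"] by (simp add: power2_sum power2_diff)
      thus "(b j)\<^sup>2 \<le> 2 * (btl_noise n L w \<omega> (upper_row n L j))\<^sup>2 + 2 * (btl_noise n L w \<omega> (lower_row L j))\<^sup>2"
        by (simp add: b_def)
    qed
    also have "\<dots> \<le> 32 * real n * V"
      using up(2) lo(2) by (simp add: sum.distrib sum_distrib_left[symmetric])
    also have "\<dots> = 512 * \<kappa>\<^sup>2 * p / real L" using n by (simp add: V_def)
    finally show ?thesis .
  qed
  have edge: "A i j = of_bool (fst \<omega> (min i j, max i j))" if "i \<noteq> j" for i j
    using that by (simp add: A_def btl_edge_def)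
  have "p\<^sup>2 * (\<Sum>i<n. (\<pi> i - \<mu> i)\<^sup>2) \<le> (512 * \<kappa> ^ 4 / real n)\<^sup>2 * (\<Sum>j<n. (b j)\<^sup>2)"
  proof (rule stationary_error_le_imbalance[where A = A and y = "btl_y L \<omega>"])
    show "(\<Sum>i<n. \<pi> i) = 1" using st by (simp add: stationary_def)
    show "A i j = A j i" for i j by (auto simp: A_def btl_edge_def min.commute max.commute)
    show "A i j * (btl_y L \<omega> i j + btl_y L \<omega> j i) = A i j" for i j
      by (cases "i = j") (simp_all add: A_def btl_edge_def btl_y_bounds(2)[OF L])
    show "(\<Sum>j<n. A i j) \<le> 4 * real n * p" if "i < n" for i
    proof -
      have "(\<Sum>j<n. A i j) = (\<Sum>j\<in>{..<n} - {i}. of_bool (fst \<omega> (min i j, max i j)))"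
        by (rule sum.mono_neutral_cong_right) (auto simp: A_def btl_edge_def)
      thus ?thesis using deg[OF that] by simp
    qed
    show "p / 2 * (real (card S) * real (card ({..<n} - S))) \<le> (\<Sum>i\<in>S. \<Sum>j\<in>{..<n} - S. A i j)" if "S \<subseteq> {..<n}" for S
    proof -
      have "(\<Sum>i\<in>S. \<Sum>j\<in>{..<n} - S. A i j) = (\<Sum>i\<in>S. \<Sum>j\<in>{..<n} - S. of_bool (fst \<omega> (min i j, max i j)))"
        by (intro sum.cong refl edge) auto
      thus ?thesis using cut[OF that] by (simp del: sum_of_bool_eq)
    qed
    show "(\<Sum>i<n. \<pi> i * (A i j * btl_y L \<omega> i j)) = \<pi> j * (\<Sum>k<n. A j k * btl_y L \<omega> j k)" if "j < n" for j
      unfolding A_def by (rule stationary_btl_P_balance[OF d st that])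
    show "b j = (\<Sum>k<n. A j k * (\<mu> j * btl_y L \<omega> j k - \<mu> k * btl_y L \<omega> k j))" if "j < n" for j
      unfolding A_def \<mu>_def b_def using btl_imbalance_eq_noise[OF L w that] by simp
  qed (use n p \<kappa>0 \<mu>b \<mu>1 small btl_y_bounds(1)[OF L] in \<open>auto simp: A_def\<close>)
  also have "\<dots> \<le> (512 * \<kappa> ^ 4 / real n)\<^sup>2 * (512 * \<kappa>\<^sup>2 * p / real L)"
    by (intro mult_left_mono B) auto
  finally have "p\<^sup>2 * (\<Sum>i<n. (\<pi> i - \<mu> i)\<^sup>2) \<le> (512 * \<kappa> ^ 4 / real n)\<^sup>2 * (512 * \<kappa>\<^sup>2 * p / real L)" .
  hence "(\<Sum>i<n. (\<pi> i - \<mu> i)\<^sup>2) \<le> (512 * \<kappa> ^ 4 / real n)\<^sup>2 * (512 * \<kappa>\<^sup>2 * p / real L) / p\<^sup>2"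
    using p by (subst pos_le_divide_eq) (simp, subst mult.commute)
  also have "\<dots> = 134217728 * (\<kappa> ^ 5)\<^sup>2 / (real n * p * real L) / real n"
  proof -
    have "(\<kappa> ^ 5)\<^sup>2 = (\<kappa> ^ 4)\<^sup>2 * \<kappa>\<^sup>2" by (simp flip: power_mult power_add)
    thus ?thesis using p n L by (simp add: power_divide power_mult_distrib) (simp add: power2_eq_square field_simps)
  qed
  \<comment> \<open>The accumulated constant is the cube of 512, rounded up to the square of
    12000.\<close>
  also have "\<dots> \<le> (12000 * \<kappa> ^ 5)\<^sup>2 / (real n * p * real L) / real n"
    using p n L by (intro divide_right_mono) (auto simp: power_mult_distrib)
  also have "\<dots> = (12000 * \<kappa> ^ 5 / sqrt (real n * p * real L))\<^sup>2 * (1 / real n)"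
    using p by (simp add: power_divide)
  also have "\<dots> \<le> (12000 * \<kappa> ^ 5 / sqrt (real n * p * real L))\<^sup>2 * (\<Sum>i<n. (\<mu> i)\<^sup>2)"
  proof (intro mult_left_mono)
    \<comment> \<open>A vector with entries summing to 1 has squared norm at least
      \<open>1 / n\<close>, which makes the bound relative to \<open>\<mu>\<close>.\<close>
    have "(\<Sum>i<n. \<mu> i * 1)\<^sup>2 \<le> (\<Sum>i<n. (\<mu> i)\<^sup>2) * (\<Sum>i<n. 1\<^sup>2)" by (rule Cauchy_Schwarz_ineq_sum)
    thus "1 / real n \<le> (\<Sum>i<n. (\<mu> i)\<^sup>2)" using n by (simp add: \<mu>1 field_simps)
  qed auto
  finally have "l2norm n (\<lambda>i. \<pi> i - \<mu> i) \<le> sqrt ((12000 * \<kappa> ^ 5 / sqrt (real n * p * real L))\<^sup>2 * (\<Sum>i<n. (\<mu> i)\<^sup>2))"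
    unfolding l2norm_def by (rule real_sqrt_le_mono)
  also have "\<dots> = 12000 * \<kappa> ^ 5 / sqrt (real n * p * real L) * l2norm n \<mu>"
    using p \<kappa>0 by (simp add: real_sqrt_mult l2norm_def)
  finally have "l2norm n (\<lambda>i. \<pi> i - \<mu> i) \<le> 12000 * \<kappa> ^ 5 / sqrt (real n * p * real L) * l2norm n \<mu>" .
  moreover have "l2norm n \<mu> > 0"
  proof -
    have "\<mu> i > 0" if "i < n" for i
      using \<mu>b(1)[OF that] \<kappa>0 n by (smt (verit) divide_pos_pos mult_pos_pos of_nat_0_less_iff)
    hence "0 < (\<Sum>i<n. (\<mu> i)\<^sup>2)"
      using n by (intro sum_pos zero_less_power) auto
    thus ?thesis by (simp add: l2norm_def)
  qed
  ultimately show ?thesis by (simp add: \<mu>_def pos_divide_le_eq)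
qed

text \<open>The factor 120 is 20 times 6: both exponentials are then at most
  \<open>1 / n ^ 6\<close>. The degrees contribute \<open>1 / n ^ 5\<close> and the cuts
  \<open>4 / n ^ 5\<close>.\<close>

lemma btl_graph_regular:
  assumes n: "0 < n" and p: "0 \<le> p" "p \<le> 1" and c0: "120 * ln (real n) \<le> real n * p"
  shows "measure_pmf.prob (btl_graph_pmf n p)
     {G. \<not> ((\<forall>i<n. (\<Sum>j\<in>{..<n} - {i}. of_bool (G (min i j, max i j))) \<le> 4 * (real n * p)) \<and>
        (\<forall>S\<subseteq>{..<n}. p / 2 * (real (card S) * real (card ({..<n} - S)))
            \<le> (\<Sum>i\<in>S. \<Sum>j\<in>{..<n} - S. of_bool (G (min i j, max i j)))))} \<le> 5 / real n ^ 5"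
    (is "measure_pmf.prob ?M ?S \<le> _")
proof -
  define D where "D i = {G. 4 * (real n * p) \<le> (\<Sum>j\<in>{..<n} - {i}. of_bool (G (min i j, max i j)))}" for i
  define B where "B = {G. \<exists>S\<subseteq>{..<n}. (\<Sum>i\<in>S. \<Sum>j\<in>{..<n} - S. of_bool (G (min i j, max i j))) < p / 2 * (real (card S) * real (card ({..<n} - S)))}"
  have Q: "exp (- (real n * p) / 20) \<le> 1 / real n ^ 6" "exp (- 2 * (real n * p)) \<le> 1 / real n ^ 6"
  proof -
    have "0 \<le> ln (real n)" using n by simp
    hence "exp (- (real n * p) / 20) \<le> exp (- (real 6 * ln (real n)))"
      "exp (- 2 * (real n * p)) \<le> exp (- (real 6 * ln (real n)))"
      using c0 by (simp_all add: mult.commute)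
    thus "exp (- (real n * p) / 20) \<le> 1 / real n ^ 6" "exp (- 2 * (real n * p)) \<le> 1 / real n ^ 6"
      unfolding exp_minus_mult_ln[OF n] .
  qed
  have n6: "real n * (1 / real n ^ 6) = 1 / real n ^ 5"
    using n by (simp add: eval_nat_numeral)
  have nQ: "real n * exp (- (real n * p) / 20) \<le> 1 / real n ^ 5" "real n * exp (- 2 * (real n * p)) \<le> 1 / real n ^ 5"
    unfolding n6[symmetric] by (intro mult_left_mono Q; simp)+
  define deg where "deg G i = (\<Sum>j\<in>{..<n} - {i}. of_bool (G (min i j, max i j)) :: real)" for G i
  define cut where "cut G S = (\<Sum>i\<in>S. \<Sum>j\<in>{..<n} - S. of_bool (G (min i j, max i j)) :: real)" for G S
  have "?S \<subseteq> (\<Union>i<n. D i) \<union> B"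
    unfolding D_def B_def deg_def[symmetric] cut_def[symmetric] by (force simp: not_le)
  hence "measure_pmf.prob ?M ?S \<le> measure_pmf.prob ?M ((\<Union>i<n. D i) \<union> B)"
    by (intro measure_pmf.finite_measure_mono) auto
  also have "\<dots> \<le> measure_pmf.prob ?M (\<Union>i<n. D i) + measure_pmf.prob ?M B"
    by (simp add: measure_Un_le)
  also have "measure_pmf.prob ?M (\<Union>i<n. D i) \<le> (\<Sum>i<n. measure_pmf.prob ?M (D i))"
    by (intro measure_pmf.finite_measure_subadditive_finite) auto
  also have "\<dots> \<le> (\<Sum>i<n. exp (- 2 * (real n * p)))"
    unfolding D_def by (intro sum_mono btl_degree_tail p) auto
  also have "\<dots> \<le> 1 / real n ^ 5" using nQ(2) by simp
  also have "measure_pmf.prob ?M B \<le> 4 * (real n * exp (- (real n * p) / 20))"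
    unfolding B_def
  proof (rule btl_all_cuts_tail[OF p])
    have "1 / real n ^ 5 \<le> 1" using n by simp
    thus "real n * exp (- (real n * p) / 20) \<le> 1" using nQ(1) by linarith
  qed
  finally show ?thesis using nQ(1) by simp
qed

lemma btl_comparisons_concentrate:
  fixes \<kappa> p :: real
  assumes n: "0 < n" and L: "L \<ge> 1" and \<kappa>: "\<kappa> > 0" and p: "p > 0"
    and w: "\<And>i. i < n \<Longrightarrow> w i > 0"
    and w\<kappa>: "\<And>i j. i < n \<Longrightarrow> j < n \<Longrightarrow> w i \<le> \<kappa> * w j"
    and deg: "\<And>i. i < n \<Longrightarrow> (\<Sum>j\<in>{..<n} - {i}. of_bool (G (min i j, max i j))) \<le> 4 * (real n * p)"
  defines "V \<equiv> 16 * \<kappa>\<^sup>2 * p / (real n * real L)"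
  shows "measure_pmf.prob (btl_comp_pmf n L w)
      {Y. \<not> ((\<forall>i<n. (btl_noise n L w (G, Y) (upper_row n L i))\<^sup>2 \<le> 3 * V * ln (real n)) \<and>
          (\<Sum>i<n. (btl_noise n L w (G, Y) (upper_row n L i))\<^sup>2) \<le> 8 * real n * V \<and>
          (\<forall>i<n. (btl_noise n L w (G, Y) (lower_row L i))\<^sup>2 \<le> 3 * V * ln (real n)) \<and>
          (\<Sum>i<n. (btl_noise n L w (G, Y) (lower_row L i))\<^sup>2) \<le> 8 * real n * V)} \<le> 6 / real n ^ 5"
    (is "measure_pmf.prob ?M ?S \<le> _")
proof -
  have V: "V > 0" using \<kappa> p n L by (simp add: V_def)
  define bad where "bad K = {Y. (\<exists>i<n. 3 * V * ln (real n) \<le> (btl_noise n L w (G, Y) (K i))\<^sup>2) \<or>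
          8 * real n * V \<le> (\<Sum>i<n. (btl_noise n L w (G, Y) (K i))\<^sup>2)}" for K
  have U: "measure_pmf.prob ?M (bad (upper_row n L)) \<le> 3 / real n ^ 5"
    unfolding bad_def
  proof (rule btl_noise_tail[OF n w])
    show "(\<Sum>t\<in>upper_row n L i. (btl_weight n L w G t)\<^sup>2) \<le> V" if "i < n" for i
      unfolding V_def by (rule btl_weight_rows(1)[OF \<kappa> L w w\<kappa> that deg[OF that]])
  qed (auto simp: upper_row_def disjoint_family_on_def V)
  have L': "measure_pmf.prob ?M (bad (lower_row L)) \<le> 3 / real n ^ 5"
    unfolding bad_def
  proof (rule btl_noise_tail[OF n w])
    show "(\<Sum>t\<in>lower_row L i. (btl_weight n L w G t)\<^sup>2) \<le> V" if "i < n" for i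
      unfolding V_def by (rule btl_weight_rows(2)[OF \<kappa> L w w\<kappa> that deg[OF that]])
  qed (auto simp: lower_row_def disjoint_family_on_def V)
  have "?S \<subseteq> bad (upper_row n L) \<union> bad (lower_row L)"
    by (auto simp: bad_def not_le)
  hence "measure_pmf.prob ?M ?S \<le> measure_pmf.prob ?M (bad (upper_row n L) \<union> bad (lower_row L))"
    by (intro measure_pmf.finite_measure_mono) auto
  also have "\<dots> \<le> measure_pmf.prob ?M (bad (upper_row n L)) + measure_pmf.prob ?M (bad (lower_row L))"
    by (simp add: measure_Un_le)
  finally show ?thesis using U L' by simp
qed

theorem theorem9:
  fixes \<kappa>\<^sub>0 c\<^sub>d :: real
  assumes "\<kappa>\<^sub>0 \<ge> 1" and "c\<^sub>d \<ge> 2"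
  shows "\<exists>c\<^sub>0 > 0. \<exists>C > 0. \<exists>C' > 0.
    \<forall>(n::nat) (L::nat) (p::real) (d::real) (w::nat \<Rightarrow> real).
      1 \<le> n \<longrightarrow> 1 \<le> L \<longrightarrow>
      (\<forall>i<n. w i > 0) \<longrightarrow>
      (\<forall>i j. i \<le> j \<and> j < n \<longrightarrow> w j \<le> w i) \<longrightarrow>
      (\<forall>i<n. \<forall>j<n. w i \<le> \<kappa>\<^sub>0 * w j) \<longrightarrow>
      p \<le> 1 \<longrightarrow> p \<ge> c\<^sub>0 * ln (real n) / real n \<longrightarrow>
      d > 0 \<longrightarrow> d \<ge> c\<^sub>d * real n * p \<longrightarrow>
      measure_pmf.prob (btl_pmf n L p w)
        {\<omega>. \<forall>\<pi>. stationary n (btl_P n L d \<omega>) \<pi> \<longrightarrow>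
              l2norm n (\<lambda>i. \<pi> i - pi_star n w i) / l2norm n (pi_star n w)
                \<le> C / sqrt (real n * p * real L)}
        \<ge> 1 - C' / real n ^ 5"
proof -
  \<comment> \<open>This value is dictated by the smallness of the imbalances; it also exceeds the
    120 required for the graph.\<close>
  define c\<^sub>0 where "c\<^sub>0 = 192 * 65536 * \<kappa>\<^sub>0 ^ 8"
  have \<kappa>8: "\<kappa>\<^sub>0 ^ 8 \<ge> 1" using assms by simp
  have main: "measure_pmf.prob (btl_pmf n L p w)
        {\<omega>. \<forall>\<pi>. stationary n (btl_P n L d \<omega>) \<pi> \<longrightarrow>
              l2norm n (\<lambda>i. \<pi> i - pi_star n w i) / l2norm n (pi_star n w)
                \<le> 12000 * \<kappa>\<^sub>0 ^ 5 / sqrt (real n * p * real L)} \<ge> 1 - 11 / real n ^ 5" (is "_ \<le> measure_pmf.prob _ ?S")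
    if n1: "1 \<le> n" and L: "1 \<le> L" and w: "\<forall>i<n. w i > 0" and w\<kappa>: "\<forall>i<n. \<forall>j<n. w i \<le> \<kappa>\<^sub>0 * w j"
      and p1: "p \<le> 1" and pc: "p \<ge> c\<^sub>0 * ln (real n) / real n" and d: "d > 0"
    for n L p d w
  \<comment> \<open>For a single item the logarithm vanishes and \<open>p\<close> need not be
    positive, but the claimed lower bound on the probability is then negative.\<close>
  proof (cases "n = 1")
    case True
    have "(0::real) \<le> measure_pmf.prob (btl_pmf n L p w) ?S" by (rule measure_nonneg)
    moreover have "1 - 11 / real n ^ 5 \<le> 0" using True by simp
    ultimately show ?thesis by linarith
  next
    case False
    hence n: "n \<ge> 2" using n1 by simp
    hence ln: "ln (real n) > 0" by simp
    have np: "192 * 65536 * \<kappa>\<^sub>0 ^ 8 * ln (real n) \<le> real n * p"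
      using pc n by (simp add: c\<^sub>0_def field_simps)
    have "120 * ln (real n) \<le> (192 * 65536 * \<kappa>\<^sub>0 ^ 8) * ln (real n)"
      using \<kappa>8 ln by (intro mult_right_mono) auto
    hence np': "120 * ln (real n) \<le> real n * p" using np by linarith
    hence "0 < real n * p" using ln by linarith
    hence p: "p > 0" using n by (simp add: zero_less_mult_iff)
    define P where "P G \<longleftrightarrow> (\<forall>i<n. (\<Sum>j\<in>{..<n} - {i}. of_bool (G (min i j, max i j))) \<le> 4 * (real n * p)) \<and>
        (\<forall>S\<subseteq>{..<n}. p / 2 * (real (card S) * real (card ({..<n} - S)))
            \<le> (\<Sum>i\<in>S. \<Sum>j\<in>{..<n} - S. of_bool (G (min i j, max i j))))" for G
    define Q where "Q \<omega> \<longleftrightarrow> (\<forall>\<pi>. stationary n (btl_P n L d \<omega>) \<pi> \<longrightarrow>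
              l2norm n (\<lambda>i. \<pi> i - pi_star n w i) / l2norm n (pi_star n w)
                \<le> 12000 * \<kappa>\<^sub>0 ^ 5 / sqrt (real n * p * real L))" for \<omega>
    \<comment> \<open>The graph fails with probability at most \<open>5 / n ^ 5\<close> and, given a
      regular graph, the comparisons with at most \<open>6 / n ^ 5\<close>; together these are the
      11 of the claim.\<close>
    have "1 - (5 / real n ^ 5 + 6 / real n ^ 5) \<le> measure_pmf.prob (btl_pmf n L p w) {\<omega>. Q \<omega>}"
      unfolding btl_pmf_def
    proof (rule prob_pair_pmf_ge[where P = P])
      show "measure_pmf.prob (btl_graph_pmf n p) {G. \<not> P G} \<le> 5 / real n ^ 5"
        unfolding P_def using n p p1 np' by (intro btl_graph_regular) auto
    next
      fix G assume PG: "P G"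
      define good where "good Y \<longleftrightarrow> (\<forall>i<n. (btl_noise n L w (G, Y) (upper_row n L i))\<^sup>2 \<le> 3 * (16 * \<kappa>\<^sub>0\<^sup>2 * p / (real n * real L)) * ln (real n)) \<and>
          (\<Sum>i<n. (btl_noise n L w (G, Y) (upper_row n L i))\<^sup>2) \<le> 8 * real n * (16 * \<kappa>\<^sub>0\<^sup>2 * p / (real n * real L)) \<and>
          (\<forall>i<n. (btl_noise n L w (G, Y) (lower_row L i))\<^sup>2 \<le> 3 * (16 * \<kappa>\<^sub>0\<^sup>2 * p / (real n * real L)) * ln (real n)) \<and>
          (\<Sum>i<n. (btl_noise n L w (G, Y) (lower_row L i))\<^sup>2) \<le> 8 * real n * (16 * \<kappa>\<^sub>0\<^sup>2 * p / (real n * real L))" for Y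
      have "Q (G, Y)" if "good Y" for Y
        unfolding Q_def
      proof (intro allI impI)
        fix \<pi> assume st: "stationary n (btl_P n L d (G, Y)) \<pi>"
        show "l2norm n (\<lambda>i. \<pi> i - pi_star n w i) / l2norm n (pi_star n w) \<le> 12000 * \<kappa>\<^sub>0 ^ 5 / sqrt (real n * p * real L)"
          by (rule btl_error_bound[OF _ L assms(1) p d _ _ np _ _ _ _ _ _ st])
             (use n w w\<kappa> PG that in \<open>auto simp: P_def good_def simp del: sum_of_bool_eq\<close>)
      qed
      hence "measure_pmf.prob (btl_comp_pmf n L w) {Y. \<not> Q (G, Y)} \<le> measure_pmf.prob (btl_comp_pmf n L w) {Y. \<not> good Y}"
        by (intro measure_pmf.finite_measure_mono) auto
      also have "\<dots> \<le> 6 / real n ^ 5"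
        unfolding good_def using n L p w w\<kappa> assms PG
        by (intro btl_comparisons_concentrate) (auto simp: P_def simp del: sum_of_bool_eq)
      finally show "measure_pmf.prob (btl_comp_pmf n L w) {Y. \<not> Q (G, Y)} \<le> 6 / real n ^ 5" .
    qed simp
    thus ?thesis by (simp add: Q_def add_divide_distrib[symmetric])
  qed
  show ?thesis
  proof (rule exI[of _ c\<^sub>0], intro conjI, goal_cases)
    case 1
    show ?case using assms by (simp add: c\<^sub>0_def)
  next
    case 2
    show ?case
      by (rule exI[of _ "12000 * \<kappa>\<^sub>0 ^ 5"], intro conjI, use assms in simp, rule exI[of _ 11])
         (use main in simp)
  qed
qed

end
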